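(* Let $\tau\in\mathbb{H}$, $r\ge1$, and let $k_1,\dots,k_r\ge2$ be integers with $k_1+\cdots+k_r=k$. Then $$\sum_{i=1}^r\sum_{\substack{n_1,\dots,n_r\geq 0\\ n_1+\cdots+n_r=k\\ n_i=1}}(-1)^{k_i+n_i+\cdots+n_r}\prod_{\substack{p=1\\ p\ne i}}^r\binom{n_p-1}{k_p-1}\,\widetilde{G}_{n_{i-1},\dots,n_1}(\tau)\,\widetilde{G}_{n_{i+1},\dots,n_r}(\tau)=0.$$
   Context: $\mathbb{H}$ is the upper half-plane, $\mathbb{Z}_N=\{n\in\mathbb{Z}: |n|<N\}$, and $\mathbb{Z}_M\tau+\mathbb{Z}_N=\{m\tau+n: m\in\mathbb{Z}_M, n\in\mathbb{Z}_N\}$. The order $\prec$ on $\mathbb{Z}\tau+\mathbb{Z}$: $m_1\tau+n_1\prec m_2\tau+n_2$ iff $m_1<m_2$, or $m_1=m_2$ and $n_1<n_2$. For integers $k_1,\dots,k_r\ge2$, $$\widetilde{G}_{k_1,\dots,k_r}(\tau)=\lim_{M\to\infty}\lim_{N\to\infty}\sum_{\substack{w_1,\dots,w_r\in\mathbb{Z}_M\tau+\mathbb{Z}_N\\ 0\prec w_1\prec\dots\prec w_r}}\frac{1}{w_1^{k_1}\cdots w_r^{k_r}},$$ and $\widetilde{G}_\emptyset=1$. Convention: $\binom{n-1}{k-1}=0$ whenever $0\le n<k$ (also for $n=0$), so terms in which $\widetilde{G}$ would formally have an index entry less than $2$ do not occur. *)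

theory Defs
  imports Complex_Main "HOL-Library.FuncSet"
begin

definition int_ball :: "nat \<Rightarrow> int set" where
  "int_ball N = {n. \<bar>n\<bar> < int N}"

definition lattice_box :: "complex \<Rightarrow> nat \<Rightarrow> nat \<Rightarrow> complex set" where
  "lattice_box \<tau> M N = {of_int m * \<tau> + of_int n | m n. m \<in> int_ball M \<and> n \<in> int_ball N}"

(* For Im \<tau> > 0 the coordinates m and n of a lattice point are unique. *)
definition lattice_less :: "complex \<Rightarrow> complex \<Rightarrow> complex \<Rightarrow> bool" where
  "lattice_less \<tau> w w' \<longleftrightarrow>
     (\<exists>m1 n1 m2 n2 :: int. w = of_int m1 * \<tau> + of_int n1 \<and> w' = of_int m2 * \<tau> + of_int n2 \<and>
        (m1 < m2 \<or> m1 = m2 \<and> n1 < n2))"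

definition lattice_chains :: "complex \<Rightarrow> nat \<Rightarrow> nat \<Rightarrow> nat \<Rightarrow> complex list set" where
  "lattice_chains \<tau> r M N =
     {ws. length ws = r \<and> set ws \<subseteq> lattice_box \<tau> M N \<and> successively (lattice_less \<tau>) (0 # ws)}"

definition mult_eisenstein_partial :: "complex \<Rightarrow> nat list \<Rightarrow> nat \<Rightarrow> nat \<Rightarrow> complex" where
  "mult_eisenstein_partial \<tau> ks M N =
     (\<Sum>ws\<in>lattice_chains \<tau> (length ks) M N. \<Prod>j<length ks. 1 / (ws ! j) ^ (ks ! j))"

(* The order of the limits matters: when some entry equals 2 the multiple series
   need not converge absolutely. *)
definition mult_eisenstein :: "complex \<Rightarrow> nat list \<Rightarrow> complex" where
  "mult_eisenstein \<tau> ks = lim (\<lambda>M. lim (\<lambda>N. mult_eisenstein_partial \<tau> ks M N))"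

lemma finite_lattice_chains: "finite (lattice_chains \<tau> r M N)"
proof -
  have "int_ball K = {- int K <..< int K}" for K
    by (auto simp: int_ball_def)
  hence "finite (int_ball K)" for K
    by simp
  moreover have "lattice_box \<tau> M N = (\<lambda>(m, n). of_int m * \<tau> + of_int n) ` (int_ball M \<times> int_ball N)"
    by (auto simp: lattice_box_def)
  ultimately have "finite (lattice_box \<tau> M N)"
    by simp
  from finite_lists_length_eq[OF this, of r] show ?thesis
    by (rule rev_finite_subset) (auto simp: lattice_chains_def)
qed

lemma mult_eisenstein_Nil: "mult_eisenstein \<tau> [] = 1"
proof -
  have "lattice_chains \<tau> 0 M N = {[]}" for M N
    by (auto simp: lattice_chains_def)
  thus ?thesis
    by (simp add: mult_eisenstein_def mult_eisenstein_partial_def)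
qed

end

theory Submission
  imports Defs
    "HOL-Computational_Algebra.Formal_Power_Series"
    "HOL-Analysis.Infinite_Sum"
    "HOL-Analysis.Summation_Tests"
    "HOL-Library.Product_Lexorder"
begin

text \<open>
Fix an increasing chain \<open>w\<^sub>1, \<dots>, w\<^sub>r\<close> of lattice points. The rational function
\<open>f z = \<Prod>p. (z + w\<^sub>p) ^ (- k\<^sub>p)\<close> has total degree at most \<open>-2\<close>, so its residues add up to zero. The
residue at \<open>z = - w\<^sub>i\<close> is a combination of the products
\<open>\<Prod>p < i. (w\<^sub>i - w\<^sub>p) ^ (- n\<^sub>p)\<close> and \<open>\<Prod>p > i. (w\<^sub>p - w\<^sub>i) ^ (- n\<^sub>p)\<close>, where \<open>n\<close> runs through the tuples
of weight \<open>k\<close> with \<open>n\<^sub>i = 1\<close>, and up to a common sign its coefficients are those of the theorem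
(\<open>sum_residues_chain\<close>).

Summing this over all chains in a rectangle of the lattice, and collecting the chains with
\<open>w\<^sub>i = s\<close>, gives products of two truncated multiple Eisenstein sums: translation by \<open>s\<close> turns the
points above \<open>s\<close> into a chain with exponents \<open>n\<^bsub>i+1\<^esub>, \<dots>, n\<^sub>r\<close>, and reflection at \<open>s\<close> turns the points
below \<open>s\<close> into a chain with exponents \<open>n\<^bsub>i-1\<^esub>, \<dots>, n\<^sub>1\<close>. The truncations depend on the position of \<open>s\<close>
in the rectangle (\<open>sum_residue_coeff_boxes\<close>). After division by the number of columns and a limit
over the width, and then by the number of rows and a limit over the height, only the points \<open>s\<close> far
from the boundary matter, and the truncated sums average to their limits
(\<open>tendsto_average_antidiagonal\<close>).

The limits exist for the following reason. Within finitely many rows the sums converge absolutely.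
When the row \<open>m\<close> is added, the increment is a sum of products of earlier sums for shorter words and
of sums over chains inside the row \<open>m\<close>; the latter are of order \<open>1 / m ^ 2\<close>
(\<open>chain_sum_row_bound\<close>). By absolute values this is clear except for the single exponent \<open>2\<close>, where
a telescoping series supplies one more factor \<open>1 / m\<close>. Hence the increments are summable
(\<open>convergent_chain_sum_strip\<close>).
\<close>

section \<open>Residues of rational functions with prescribed poles\<close>

definition exponent_tuples :: "'i set \<Rightarrow> nat \<Rightarrow> ('i \<Rightarrow> nat) set" where
  "exponent_tuples I k = {n \<in> I \<rightarrow>\<^sub>E UNIV. sum n I = k}"

lemma finite_exponent_tuples:
  assumes "finite I"
  shows "finite (exponent_tuples I k)"
proof (rule finite_subset)
  show "exponent_tuples I k \<subseteq> I \<rightarrow>\<^sub>E {..k}"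
  proof
    fix n assume "n \<in> exponent_tuples I k"
    then have n: "n \<in> I \<rightarrow>\<^sub>E UNIV" "sum n I = k"
      by (auto simp: exponent_tuples_def)
    have "n i \<le> k" if "i \<in> I" for i
      using member_le_sum[of i I n] assms that n by simp
    then show "n \<in> I \<rightarrow>\<^sub>E {..k}"
      using n by (simp add: PiE_iff)
  qed
  show "finite (I \<rightarrow>\<^sub>E {..k})"
    using assms by (intro finite_PiE) auto
qed

lemma fps_nth_prod_exponent_tuples:
  fixes F :: "'i \<Rightarrow> 'a::comm_ring_1 fps"
  assumes "finite I"
  shows "fps_nth (\<Prod>i\<in>I. F i) k = (\<Sum>n\<in>exponent_tuples I k. \<Prod>i\<in>I. fps_nth (F i) (n i))"
  using assms
proof (induction I arbitrary: k rule: finite_induct)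
  case empty
  have "exponent_tuples ({} :: 'i set) k = (if k = 0 then {\<lambda>_. undefined} else {})"
    by (auto simp: exponent_tuples_def)
  then show ?case
    by (cases "k = 0") simp_all
next
  case (insert a I)
  have "fps_nth (\<Prod>i\<in>insert a I. F i) k
      = (\<Sum>j\<le>k. fps_nth (F a) j * (\<Sum>n\<in>exponent_tuples I (k - j). \<Prod>i\<in>I. fps_nth (F i) (n i)))"
    using insert.hyps by (simp add: fps_mult_nth insert.IH atLeast0AtMost)
  also have "\<dots> = (\<Sum>(j, n)\<in>(SIGMA j:{..k}. exponent_tuples I (k - j)).
      fps_nth (F a) j * (\<Prod>i\<in>I. fps_nth (F i) (n i)))"
    by (subst sum.Sigma[symmetric]) (auto simp: sum_distrib_left finite_exponent_tuples insert.hyps)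
  also have "\<dots> = (\<Sum>n\<in>exponent_tuples (insert a I) k. \<Prod>i\<in>insert a I. fps_nth (F i) (n i))"
  proof (rule sum.reindex_bij_witness[where j = "\<lambda>(j, n). n(a := j)" and
        i = "\<lambda>n. (n a, n(a := undefined))"])
    fix x assume x: "x \<in> (SIGMA j:{..k}. exponent_tuples I (k - j))"
    obtain j n where jn: "x = (j, n)" "j \<le> k" "n \<in> I \<rightarrow>\<^sub>E UNIV" "sum n I = k - j"
      using x by (auto simp: exponent_tuples_def)
    have na: "n a = undefined"
      using jn insert.hyps by (auto simp: PiE_iff extensional_def)
    have s: "sum (n(a := j)) I = sum n I"
      using insert.hyps by (intro sum.cong) auto
    have p: "(\<Prod>i\<in>I. fps_nth (F i) ((n(a := j)) i)) = (\<Prod>i\<in>I. fps_nth (F i) (n i))"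
      using insert.hyps by (intro prod.cong) auto
    show "(case x of (j, n) \<Rightarrow> n(a := j)) \<in> exponent_tuples (insert a I) k"
      using jn insert.hyps s by (auto simp: exponent_tuples_def PiE_iff extensional_def)
    show "(\<lambda>n. (n a, n(a := undefined))) (case x of (j, n) \<Rightarrow> n(a := j)) = x"
      using jn na by (auto simp: fun_eq_iff)
    show "(\<Prod>i\<in>insert a I. fps_nth (F i) ((case x of (j, n) \<Rightarrow> n(a := j)) i))
        = (case x of (j, n) \<Rightarrow> fps_nth (F a) j * (\<Prod>i\<in>I. fps_nth (F i) (n i)))"
      using jn insert.hyps p by simp
  next
    fix n assume n: "n \<in> exponent_tuples (insert a I) k"
    have s: "sum (n(a := undefined)) I = sum n I"
      using insert.hyps by (intro sum.cong) auto
    show "(n a, n(a := undefined)) \<in> (SIGMA j:{..k}. exponent_tuples I (k - j))"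
      using n insert.hyps s by (auto simp: exponent_tuples_def PiE_iff extensional_def)
    show "(\<lambda>(j, n). n(a := j)) (n a, n(a := undefined)) = n"
      by auto
  qed
  finally show ?case .
qed

text \<open>
The factor \<open>X / (X + c)\<close>, which is \<open>1\<close> for \<open>c = 0\<close>. The Laurent series of
\<open>\<Prod>p. (X + c p) ^ (- k p)\<close>, multiplied by \<open>X\<close> to the power \<open>\<Sum>p. k p\<close>, becomes the power
series \<open>\<Prod>p. fps_pole (c p) ^ k p\<close>; its residue at \<open>0\<close> is therefore the coefficient of this
product at \<open>(\<Sum>p. k p) - 1\<close>, and no negative exponents are needed.
\<close>

definition fps_pole :: "'a::field \<Rightarrow> 'a fps" where
  "fps_pole c = (if c = 0 then 1 else fps_X * inverse (fps_X + fps_const c))"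

lemma fps_pole_mult: "(fps_X + fps_const c) * fps_pole c = fps_X"
proof (cases "c = 0")
  case False
  then have "inverse (fps_X + fps_const c) * (fps_X + fps_const c) = 1"
    by (intro inverse_mult_eq_1) simp
  then show ?thesis
    using False by (simp add: fps_pole_def mult.left_commute mult.commute)
qed (simp add: fps_pole_def)

lemma fps_pole_partial_fraction:
  "fps_const (d - c) * (fps_pole c * fps_pole d) = fps_X * fps_pole c - fps_X * fps_pole d"
proof -
  have "fps_const (d - c) * (fps_pole c * fps_pole d)
     = fps_pole c * ((fps_X + fps_const d) * fps_pole d) - ((fps_X + fps_const c) * fps_pole c) * fps_pole d"
    by (simp add: algebra_simps flip: fps_const_sub)
  then show ?thesis
    by (simp only: fps_pole_mult) (simp only: mult.commute)
qed

text \<open>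
The negative binomial series. The truncated subtraction in the binomial coefficient makes it
vanish for all \<open>n < k\<close>, including \<open>n = 0\<close>, because \<open>k - 1 > 0\<close>; so no case distinction
is needed for the first \<open>k\<close> coefficients.
\<close>

lemma fps_nth_fps_pole_power:
  fixes c :: "'a::field_char_0"
  assumes "c \<noteq> 0" "k \<ge> 2"
  shows "fps_nth (fps_pole c ^ k) n = (-1) ^ (n + k) * of_nat ((n - 1) choose (k - 1)) / c ^ n"
proof -
  have eq: "fps_X + fps_const c = fps_const c * (1 - fps_const (- inverse c) * fps_X)"
    using assms by (intro fps_ext) (auto simp: fps_X_def)
  have "fps_pole c ^ k
      = fps_const (inverse c ^ k) * (fps_X ^ k * inverse ((1 - fps_const (- inverse c) * fps_X) ^ k))"
    using assms unfolding fps_pole_def eq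
    by (simp add: fps_inverse_mult power_mult_distrib fps_inverse_power fps_const_inverse fps_const_power mult_ac
        del: fps_const_neg)
  also have "fps_nth \<dots> n = (if n < k then 0 else
      inverse c ^ k * (of_nat ((k + (n - k) - 1) choose (n - k)) * (- inverse c) ^ (n - k)))"
    using assms by (subst one_minus_const_fps_X_neg_power') (auto simp: fps_X_power_mult_nth)
  also have "\<dots> = (-1) ^ (n + k) * of_nat ((n - 1) choose (k - 1)) / c ^ n"
  proof (cases "n < k")
    case True
    then show ?thesis using assms by (auto simp: binomial_eq_0)
  next
    case False
    then obtain m where m: "n = k + m" by (metis le_add_diff_inverse not_less)
    have "(k + m - 1) choose m = (k + m - 1) choose (k - 1)"
      using assms by (subst binomial_symmetric) auto
    moreover have "(- inverse c) ^ m = (-1) ^ m * inverse c ^ m"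
      by (metis power_minus)
    ultimately show ?thesis
      using m assms by (simp add: power_add field_simps flip: power_mult_distrib)
  qed
  finally show ?thesis .
qed

text \<open>
The summand for \<open>i\<close> is the residue at \<open>z = - w i\<close> of \<open>f z = \<Prod>p. (z + w p) ^ (- k p)\<close>.
The residues of a rational function that vanishes at infinity add up to the coefficient of
\<open>1 / z\<close> in its expansion at infinity, which is \<open>1\<close> if \<open>f\<close> has degree \<open>-1\<close> and \<open>0\<close> if the
degree is at most \<open>-2\<close>. As long as two different poles occur, the identity
\<open>(w q - w p) / ((z + w p) (z + w q)) = 1 / (z + w p) - 1 / (z + w q)\<close> expresses the sum by two
sums of one degree higher, which agree by induction; for a single pole it is read off.
\<close>

lemma sum_fps_nth_pole_products:
  fixes w :: "'i \<Rightarrow> 'a::field"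
  assumes "finite I" "inj_on w I" "sum k I \<ge> 1"
  shows "(\<Sum>i\<in>I. fps_nth (\<Prod>p\<in>I. fps_pole (w p - w i) ^ k p) (sum k I - 1))
         = (if sum k I = 1 then 1 else 0)"
  using assms(3)
proof (induction "sum k I" arbitrary: k rule: less_induct)
  case less
  define Q where "Q = (\<lambda>k i. \<Prod>p\<in>I. fps_pole (w p - w i) ^ k p)"
  define R where "R = (\<lambda>k. \<Sum>i\<in>I. fps_nth (Q k i) (sum k I - 1))"
  have IH: "R k' = (if sum k' I = 1 then 1 else 0)" if "sum k' I < sum k I" "sum k' I \<ge> 1" for k'
    using less.hyps[OF that] unfolding R_def Q_def .
  have "R k = (if sum k I = 1 then 1 else 0)"
  proof (cases "\<exists>p\<in>I. \<exists>q\<in>I. p \<noteq> q \<and> k p > 0 \<and> k q > 0")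
    case True
    then obtain p q where pq: "p \<in> I" "q \<in> I" "p \<noteq> q" "k p > 0" "k q > 0" by blast
    define kp kq where "kp = k(p := k p - 1)" and "kq = k(q := k q - 1)"
    have Idiff: "I - {p,q} = I - {p} - {q}" by blast
    have sum_split: "sum f I = f p + f q + sum f (I - {p,q})" for f :: "'i \<Rightarrow> nat"
      using assms(1) pq by (subst sum.remove[of I p], simp_all, subst sum.remove[of "I - {p}" q])
        (simp_all add: Idiff)
    have prod_split: "Q f i = fps_pole (w p - w i) ^ f p * fps_pole (w q - w i) ^ f q
        * (\<Prod>x\<in>I - {p,q}. fps_pole (w x - w i) ^ f x)" for f i
      using assms(1) pq unfolding Q_def
      by (subst prod.remove[of I p], simp_all, subst prod.remove[of "I - {p}" q])
        (simp_all add: Idiff mult.assoc)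
    have same: "sum kp (I - {p,q}) = sum k (I - {p,q})" "sum kq (I - {p,q}) = sum k (I - {p,q})"
      by (auto simp: kp_def kq_def intro!: sum.cong)
    have same': "(\<Prod>x\<in>I - {p,q}. fps_pole (w x - w i) ^ kp x) = (\<Prod>x\<in>I - {p,q}. fps_pole (w x - w i) ^ k x)"
      "(\<Prod>x\<in>I - {p,q}. fps_pole (w x - w i) ^ kq x) = (\<Prod>x\<in>I - {p,q}. fps_pole (w x - w i) ^ k x)" for i
      by (auto simp: kp_def kq_def intro!: prod.cong)
    have sums: "sum k I = Suc (sum kp I)" "sum kq I = sum kp I" "sum kp I \<ge> 1"
      using pq same by (auto simp: sum_split[of k] sum_split[of kp] sum_split[of kq]) (auto simp: kp_def kq_def)
    obtain s where s: "sum kp I = Suc s" using sums(3) by (cases "sum kp I") auto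
    \<comment> \<open>Partial fractions for the poles \<open>p\<close> and \<open>q\<close>, multiplied by all other factors.\<close>
    have Qrec: "fps_const (w q - w p) * Q k i = fps_X * Q kq i - fps_X * Q kp i" for i
    proof -
      obtain a b where ab: "k p = Suc a" "k q = Suc b" using pq by (metis gr0_implies_Suc)
      define r where "r = (\<Prod>x\<in>I - {p,q}. fps_pole (w x - w i) ^ k x)"
      define P P' where "P = fps_pole (w p - w i)" and "P' = fps_pole (w q - w i)"
      have pf: "fps_const (w q - w p) * (P * P') = fps_X * P - fps_X * P'"
        using fps_pole_partial_fraction[of "w q - w i" "w p - w i"] by (simp add: P_def P'_def)
      have Q: "Q k i = (P * P') * (P ^ a * P' ^ b * r)"
        "Q kq i = P * (P ^ a * P' ^ b * r)" "Q kp i = P' * (P ^ a * P' ^ b * r)"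
        using pq(3) ab by (simp_all add: prod_split same' r_def[symmetric] P_def[symmetric] P'_def[symmetric])
          (simp_all add: kp_def kq_def mult_ac)
      have "fps_const (w q - w p) * Q k i = (fps_const (w q - w p) * (P * P')) * (P ^ a * P' ^ b * r)"
        unfolding Q(1) by (simp only: mult.assoc)
      also have "\<dots> = fps_X * Q kq i - fps_X * Q kp i"
        unfolding pf Q(2,3) by (simp add: algebra_simps)
      finally show ?thesis .
    qed
    have "(w q - w p) * R k = (\<Sum>i\<in>I. fps_nth (fps_const (w q - w p) * Q k i) (sum k I - 1))"
      by (simp add: R_def sum_distrib_left)
    also have "\<dots> = R kq - R kp"
      unfolding Qrec by (simp add: R_def sums(1,2) s sum_subtractf)
    also have "\<dots> = 0"
      using IH[of kp] IH[of kq] sums by simp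
    finally have "R k = 0"
      using assms(2) pq by (auto simp: inj_on_def)
    then show ?thesis
      using sums by simp
  next
    case False
    obtain p where p: "p \<in> I" "k p > 0"
      using less.prems by (metis One_nat_def not_one_le_zero sum.neutral neq0_conv)
    have z: "k x = 0" if "x \<in> I" "x \<noteq> p" for x using False p that by (metis neq0_conv)
    have sk: "sum k I = k p"
      using assms(1) p z by (subst sum.remove[of I p]) auto
    have Q: "Q k i = fps_pole (w p - w i) ^ k p" for i
      unfolding Q_def using assms(1) p z by (subst prod.remove[of I p]) auto
    have nz: "fps_nth (Q k i) (sum k I - 1) = 0" if "i \<in> I" "i \<noteq> p" for i
    proof -
      have "w p - w i \<noteq> 0" using assms(2) p that by (auto simp: inj_on_def)
      then show ?thesis
        using p by (simp add: Q fps_pole_def power_mult_distrib fps_X_power_mult_nth sk)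
    qed
    have "R k = fps_nth (Q k p) (sum k I - 1)"
      unfolding R_def using assms(1) p nz by (subst sum.remove[of I p]) auto
    then show ?thesis using p by (auto simp: Q sk fps_pole_def)
  qed
  then show ?case unfolding R_def Q_def .
qed

text \<open>
The residue at \<open>- w i\<close>, multiplied out. The factor of the pole itself is \<open>1\<close>, and replacing it
by \<open>X\<close> shifts the coefficient from \<open>(\<Sum>p. k p) - 1\<close> to \<open>\<Sum>p. k p\<close>. This is why the tuples
sum to the weight and have entry \<open>1\<close> at position \<open>i\<close>.
\<close>

lemma fps_nth_pole_product_expansion:
  fixes w :: "'i \<Rightarrow> 'a::field_char_0"
  assumes "finite I" "inj_on w I" "i \<in> I" "\<And>p. p \<in> I \<Longrightarrow> k p \<ge> 2"
  shows "fps_nth (\<Prod>p\<in>I. fps_pole (w p - w i) ^ k p) (sum k I - 1)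
    = (\<Sum>n | n \<in> exponent_tuples I (sum k I) \<and> n i = 1. \<Prod>p\<in>I - {i}.
        (-1) ^ (n p + k p) * of_nat ((n p - 1) choose (k p - 1)) / (w p - w i) ^ n p)"
proof -
  define F where "F p = (if p = i then fps_X else fps_pole (w p - w i) ^ k p)" for p
  have pos: "sum k I \<ge> 1"
    using assms(4)[OF assms(3)] member_le_sum[of i I k] assms(1,3) by simp
  have "(\<Prod>p\<in>I. F p) = fps_X * (\<Prod>p\<in>I - {i}. fps_pole (w p - w i) ^ k p)"
    using assms(1,3) by (simp add: prod.remove[of I i] F_def)
  also have "(\<Prod>p\<in>I - {i}. fps_pole (w p - w i) ^ k p) = (\<Prod>p\<in>I. fps_pole (w p - w i) ^ k p)"
    using assms(1,3) by (simp add: prod.remove[of I i] fps_pole_def)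
  finally have "fps_nth (\<Prod>p\<in>I. fps_pole (w p - w i) ^ k p) (sum k I - 1) = fps_nth (\<Prod>p\<in>I. F p) (sum k I)"
    using pos by simp
  also have "\<dots> = (\<Sum>n\<in>exponent_tuples I (sum k I). \<Prod>p\<in>I. fps_nth (F p) (n p))"
    by (rule fps_nth_prod_exponent_tuples[OF assms(1)])
  also have "\<dots> = (\<Sum>n | n \<in> exponent_tuples I (sum k I) \<and> n i = 1. \<Prod>p\<in>I. fps_nth (F p) (n p))"
  proof (rule sum.mono_neutral_right)
    show "\<forall>n\<in>exponent_tuples I (sum k I) - {n \<in> exponent_tuples I (sum k I). n i = 1}.
        (\<Prod>p\<in>I. fps_nth (F p) (n p)) = 0"
      using assms(1,3) by (auto simp: F_def fps_X_nth intro!: prod_zero)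
  qed (auto simp: finite_exponent_tuples assms(1))
  also have "\<dots> = (\<Sum>n | n \<in> exponent_tuples I (sum k I) \<and> n i = 1. \<Prod>p\<in>I - {i}.
        (-1) ^ (n p + k p) * of_nat ((n p - 1) choose (k p - 1)) / (w p - w i) ^ n p)"
  proof (rule sum.cong[OF refl])
    fix n assume n: "n \<in> {n \<in> exponent_tuples I (sum k I). n i = 1}"
    have "(\<Prod>p\<in>I. fps_nth (F p) (n p)) = (\<Prod>p\<in>I - {i}. fps_nth (F p) (n p))"
      using assms(1,3) n by (simp add: prod.remove[of I i] F_def fps_X_nth)
    also have "\<dots> = (\<Prod>p\<in>I - {i}.
        (-1) ^ (n p + k p) * of_nat ((n p - 1) choose (k p - 1)) / (w p - w i) ^ n p)"
    proof (rule prod.cong[OF refl])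
      fix p assume p: "p \<in> I - {i}"
      have "w p - w i \<noteq> 0"
        using assms(2,3) p by (auto simp: inj_on_def)
      then show "fps_nth (F p) (n p)
          = (-1) ^ (n p + k p) * of_nat ((n p - 1) choose (k p - 1)) / (w p - w i) ^ n p"
        using fps_nth_fps_pole_power[of "w p - w i" "k p" "n p"] p assms(4)[of p] by (simp add: F_def)
    qed
    finally show "(\<Prod>p\<in>I. fps_nth (F p) (n p)) = (\<Prod>p\<in>I - {i}.
        (-1) ^ (n p + k p) * of_nat ((n p - 1) choose (k p - 1)) / (w p - w i) ^ n p)" .
  qed
  finally show ?thesis .
qed

abbreviation residue_tuples :: "nat \<Rightarrow> nat \<Rightarrow> nat \<Rightarrow> (nat \<Rightarrow> nat) set" where
  "residue_tuples r k i \<equiv>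
     {n. n \<in> {1..r} \<rightarrow>\<^sub>E (UNIV :: nat set) \<and> (\<Sum>p=1..r. n p) = k \<and> n i = 1}"

text \<open>
This is \<open>(-1) ^ (k + 1)\<close>, with \<open>k\<close> the weight, times the coefficient with which the tuple \<open>n\<close>
enters the residue at \<open>- w i\<close>, once the factors below position \<open>i\<close> are written with
\<open>w i - w p\<close> in place of \<open>w p - w i\<close>.
\<close>

definition residue_coeff :: "(nat \<Rightarrow> nat) \<Rightarrow> nat \<Rightarrow> nat \<Rightarrow> (nat \<Rightarrow> nat) \<Rightarrow> complex" where
  "residue_coeff ks r i n = (-1) ^ (ks i + (\<Sum>p=i..r. n p))
     * (\<Prod>p\<in>{1..r} - {i}. of_nat ((n p - 1) choose (ks p - 1)))"

text \<open>
The identity behind the theorem, for one chain of distinct points: the residues of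
\<open>\<Prod>p. (z + w p) ^ (- ks p)\<close> cancel. The differences are oriented so that all of them are
positive in the order of the lattice once \<open>w\<close> is increasing.
\<close>

lemma sum_residues_chain:
  fixes w :: "nat \<Rightarrow> complex"
  assumes "r \<ge> 1" "inj_on w {1..r}" "\<And>p. p \<in> {1..r} \<Longrightarrow> ks p \<ge> 2" "(\<Sum>p=1..r. ks p) = k"
  shows "(\<Sum>i=1..r. \<Sum>n\<in>residue_tuples r k i. residue_coeff ks r i n
           * (\<Prod>p\<in>{1..<i}. 1 / (w i - w p) ^ n p) * (\<Prod>p\<in>{Suc i..r}. 1 / (w p - w i) ^ n p)) = 0"
    (is "(\<Sum>i=1..r. \<Sum>n\<in>_. ?t i n) = 0")
proof -
  have tuples: "residue_tuples r k i = {n. n \<in> exponent_tuples {1..r} k \<and> n i = 1}" for i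
    by (auto simp: exponent_tuples_def)
  have k2: "k \<ge> 2"
    using member_le_sum[of 1 "{1..r}" ks] assms by fastforce
  \<comment> \<open>The two sign conventions differ by the factor \<open>(-1) ^ (k + 1)\<close>, which does not depend on
    the pole.\<close>
  have sign: "?t i n = (-1) ^ (k + 1) * (\<Prod>p\<in>{1..r} - {i}.
        (-1) ^ (n p + ks p) * of_nat ((n p - 1) choose (ks p - 1)) / (w p - w i) ^ n p)"
    if i: "i \<in> {1..r}" and n: "n i = 1" for i n
  proof -
    have split: "{1..r} - {i} = {1..<i} \<union> {Suc i..r}"
      using i by auto
    have split_prod: "(\<Prod>p\<in>{1..r} - {i}. g p) = (\<Prod>p\<in>{1..<i}. g p) * (\<Prod>p\<in>{Suc i..r}. g p)" for g :: "nat \<Rightarrow> complex"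
      unfolding split by (rule prod.union_disjoint) auto
    define T where "T = (\<Sum>p=Suc i..r. n p)"
    define S where "S = (\<Sum>p\<in>{1..r} - {i}. ks p)"
    have k: "k = ks i + S"
      unfolding S_def assms(4)[symmetric] using i by (intro sum.remove) auto
    have T: "(\<Sum>p=i..r. n p) = Suc T"
      using i n by (simp add: T_def sum.atLeast_Suc_atMost)
    have "(\<Prod>p\<in>{1..r} - {i}. (-1) ^ (n p + ks p) * of_nat ((n p - 1) choose (ks p - 1)) / (w p - w i) ^ n p)
      = (\<Prod>p\<in>{1..r} - {i}. (-1) ^ ks p) * (\<Prod>p\<in>{1..r} - {i}. of_nat ((n p - 1) choose (ks p - 1)))
        * (\<Prod>p\<in>{1..r} - {i}. (-1) ^ n p / (w p - w i) ^ n p)"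
      unfolding prod.distrib[symmetric] by (intro prod.cong refl) (simp add: power_add)
    also have "(\<Prod>p\<in>{1..r} - {i}. (-1) ^ ks p) = ((-1) ^ S :: complex)"
      by (simp add: S_def power_sum)
    also have "(\<Prod>p\<in>{1..r} - {i}. (-1) ^ n p / (w p - w i) ^ n p)
      = (\<Prod>p\<in>{1..<i}. 1 / (w i - w p) ^ n p) * ((-1) ^ T * (\<Prod>p\<in>{Suc i..r}. 1 / (w p - w i) ^ n p))"
    proof -
      have "(-1) ^ m / (x - y) ^ m = 1 / (y - x) ^ m" for x y :: complex and m
      proof -
        have "(x - y) ^ m = (-1) ^ m * (y - x) ^ m"
          unfolding power_mult_distrib[symmetric] by simp
        then show ?thesis
          by simp
      qed
      then show ?thesis
        unfolding split_prod T_def power_sum prod.distrib[symmetric] by simp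
    qed
    finally have "(\<Prod>p\<in>{1..r} - {i}. (-1) ^ (n p + ks p) * of_nat ((n p - 1) choose (ks p - 1)) / (w p - w i) ^ n p)
      = (-1) ^ S * (\<Prod>p\<in>{1..r} - {i}. of_nat ((n p - 1) choose (ks p - 1)))
        * ((\<Prod>p\<in>{1..<i}. 1 / (w i - w p) ^ n p) * ((-1) ^ T * (\<Prod>p\<in>{Suc i..r}. 1 / (w p - w i) ^ n p)))" .
    moreover have "(-1::complex) ^ (ks i + Suc T) = (-1) ^ (k + 1) * (-1) ^ S * (-1) ^ T"
      unfolding k by (cases "even S"; cases "even T"; cases "even (ks i)") simp_all
    ultimately show ?thesis
      by (simp add: residue_coeff_def T mult_ac)
  qed
  have "(\<Sum>i=1..r. \<Sum>n\<in>residue_tuples r k i. ?t i n)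
     = (\<Sum>i=1..r. (-1) ^ (k + 1) * fps_nth (\<Prod>p=1..r. fps_pole (w p - w i) ^ ks p) (k - 1))"
  proof (rule sum.cong[OF refl])
    fix i assume i: "i \<in> {1..r}"
    have "(\<Sum>n\<in>residue_tuples r k i. ?t i n) = (\<Sum>n\<in>residue_tuples r k i. (-1) ^ (k + 1) * (\<Prod>p\<in>{1..r} - {i}.
        (-1) ^ (n p + ks p) * of_nat ((n p - 1) choose (ks p - 1)) / (w p - w i) ^ n p))"
      using i by (intro sum.cong refl sign) auto
    also have "\<dots> = (-1) ^ (k + 1) * fps_nth (\<Prod>p=1..r. fps_pole (w p - w i) ^ ks p) (k - 1)"
      using fps_nth_pole_product_expansion[of "{1..r}" w i ks] assms i
      unfolding tuples by (simp add: sum_distrib_left)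
    finally show "(\<Sum>n\<in>residue_tuples r k i. ?t i n)
      = (-1) ^ (k + 1) * fps_nth (\<Prod>p=1..r. fps_pole (w p - w i) ^ ks p) (k - 1)" .
  qed
  also have "\<dots> = 0"
    using sum_fps_nth_pole_products[of "{1..r}" w ks] assms k2
    by (simp add: sum_distrib_left[symmetric] sum_negf)
  finally show ?thesis .
qed

section \<open>Sums over increasing chains\<close>

definition sorted_chains :: "nat \<Rightarrow> 'a::linorder set \<Rightarrow> 'a list set" where
  "sorted_chains l B = {ws. length ws = l \<and> sorted_wrt (<) ws \<and> set ws \<subseteq> B}"

definition chain_term :: "('a \<Rightarrow> complex) \<Rightarrow> nat list \<Rightarrow> 'a list \<Rightarrow> complex" where
  "chain_term \<phi> ks ws = (\<Prod>(k, w)\<leftarrow>zip ks ws. 1 / \<phi> w ^ k)"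

text \<open>
An unordered infinite sum, so that one notion serves for finite windows of the lattice and for
the infinite rows and strips which they exhaust.
\<close>

definition chain_sum :: "('a::linorder \<Rightarrow> complex) \<Rightarrow> nat list \<Rightarrow> 'a set \<Rightarrow> complex" where
  "chain_sum \<phi> ks B = (\<Sum>\<^sub>\<infinity>ws\<in>sorted_chains (length ks) B. chain_term \<phi> ks ws)"

lemma finite_chains: "finite B \<Longrightarrow> finite (sorted_chains l B)"
  by (rule finite_subset[OF _ finite_lists_length_eq[of B l]]) (auto simp: sorted_chains_def)

lemma sorted_chains_mono: "A \<subseteq> B \<Longrightarrow> sorted_chains l A \<subseteq> sorted_chains l B"
  by (auto simp: sorted_chains_def)

lemma sorted_chains_0 [simp]: "sorted_chains 0 B = {[]}"
  by (auto simp: sorted_chains_def)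

lemma chain_sum_finite:
  "finite B \<Longrightarrow> chain_sum \<phi> ks B = (\<Sum>ws\<in>sorted_chains (length ks) B. chain_term \<phi> ks ws)"
  by (simp add: chain_sum_def finite_chains)

lemma chain_sum_Nil [simp]: "chain_sum \<phi> [] B = 1"
  by (simp add: chain_sum_def chain_term_def)

lemma chain_term_append:
  "length us = length ks \<Longrightarrow> chain_term \<phi> (ks @ ls) (us @ vs) = chain_term \<phi> ks us * chain_term \<phi> ls vs"
  by (simp add: chain_term_def)

lemma chain_term_nth:
  "length ws = length ks \<Longrightarrow> chain_term \<phi> ks ws = (\<Prod>j<length ks. 1 / \<phi> (ws ! j) ^ (ks ! j))"
  by (simp add: chain_term_def prod.list_conv_set_nth atLeast0LessThan split_beta)

lemma chain_term_map: "chain_term \<phi> ks (map h ws) = chain_term (\<phi> \<circ> h) ks ws"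
  by (simp add: chain_term_def zip_map2 comp_def case_prod_unfold)

lemma chain_term_rev:
  assumes "length ws = length ks"
  shows "chain_term \<phi> (rev ks) (rev ws) = chain_term \<phi> ks ws"
  by (simp add: chain_term_def zip_rev[OF assms[symmetric]] rev_map[symmetric] prod_list.rev)

lemma sorted_wrt_less_map_strict_mono_on:
  assumes "strict_mono_on X h" "set ws \<subseteq> X" "sorted_wrt (<) ws"
  shows "sorted_wrt (<) (map h ws)"
  unfolding sorted_wrt_map
  by (rule sorted_wrt_mono_rel[OF _ assms(3)]) (use assms(1,2) in \<open>auto simp: strict_mono_on_def\<close>)

lemma sorted_chains_image:
  assumes "strict_mono_on B h"
  shows "sorted_chains l (h ` B) = map h ` sorted_chains l B"
proof
  show "map h ` sorted_chains l B \<subseteq> sorted_chains l (h ` B)"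
  proof (intro subsetI, elim imageE)
    fix xs ws assume "xs = map h ws" "ws \<in> sorted_chains l B"
    then show "xs \<in> sorted_chains l (h ` B)"
      using sorted_wrt_less_map_strict_mono_on[OF assms, of ws] image_mono[of "set ws" B h]
      by (simp add: sorted_chains_def)
  qed
  show "sorted_chains l (h ` B) \<subseteq> map h ` sorted_chains l B"
  proof
    fix ws assume ws: "ws \<in> sorted_chains l (h ` B)"
    define us where "us = map (inv_into B h) ws"
    have inj: "inj_on h B"
      using assms by (rule strict_mono_on_imp_inj_on)
    have eq: "ws = map h us"
    proof (rule nth_equalityI)
      fix i assume "i < length ws"
      then have "ws ! i \<in> h ` B"
        using ws nth_mem by (fastforce simp: sorted_chains_def)
      then show "ws ! i = map h us ! i"
        using \<open>i < length ws\<close> by (simp add: us_def f_inv_into_f)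
    qed (simp add: us_def)
    have sub: "set us \<subseteq> B"
      using ws by (auto simp: us_def sorted_chains_def intro!: inv_into_into)
    have "sorted_wrt (\<lambda>x y. h x < h y) us"
      using ws unfolding eq by (simp add: sorted_chains_def sorted_wrt_map)
    then have "sorted_wrt (<) us"
      by (rule sorted_wrt_mono_rel[rotated])
        (use sub strict_mono_on_less[OF assms] in blast)
    then have "us \<in> sorted_chains l B"
      using ws sub by (simp add: sorted_chains_def us_def)
    then show "ws \<in> map h ` sorted_chains l B"
      using eq by blast
  qed
qed

lemma chain_sum_image:
  assumes "strict_mono_on B h"
  shows "chain_sum \<phi> ks (h ` B) = chain_sum (\<phi> \<circ> h) ks B"
proof -
  have "inj_on (map h) (sorted_chains (length ks) B)"
    using strict_mono_on_imp_inj_on[OF assms]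
    by (intro inj_on_mapI inj_on_subset[OF _ UN_least]) (auto simp: sorted_chains_def)
  then show ?thesis
    unfolding chain_sum_def sorted_chains_image[OF assms]
    by (subst infsum_reindex) (auto simp: comp_def chain_term_map)
qed

lemma rev_map_in_sorted_chains:
  assumes "ws \<in> sorted_chains l X" "\<And>x y. x \<in> X \<Longrightarrow> y \<in> X \<Longrightarrow> x < y \<Longrightarrow> f y < f x"
  shows "rev (map f ws) \<in> sorted_chains l (f ` X)"
proof -
  have "sorted_wrt (\<lambda>x y. f y < f x) ws"
    by (rule sorted_wrt_mono_rel[of ws "(<)"]) (use assms in \<open>auto simp: sorted_chains_def\<close>)
  then show ?thesis
    using assms by (auto simp: sorted_chains_def sorted_wrt_rev sorted_wrt_map)
qed

text \<open>
A reflection reverses the chains and with them the list of exponents; this is where the reversed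
index \<open>n\<^bsub>i-1\<^esub>, \<dots>, n\<^sub>1\<close> comes from.
\<close>

lemma chain_sum_antimono_image:
  assumes "\<And>x y. x \<in> B \<Longrightarrow> y \<in> B \<Longrightarrow> x < y \<Longrightarrow> h y < h x"
    and "\<And>x. x \<in> B \<Longrightarrow> g (h x) = x" "\<And>x. x \<in> B \<Longrightarrow> \<phi> (h x) = \<psi> x"
    and "\<And>x y. x \<in> h ` B \<Longrightarrow> y \<in> h ` B \<Longrightarrow> x < y \<Longrightarrow> g y < g x"
  shows "chain_sum \<phi> (rev ks) (h ` B) = chain_sum \<psi> ks B"
proof -
  have gB: "g ` h ` B = B"
    using assms(2) by force
  show ?thesis
    unfolding chain_sum_def
  proof (rule infsum_reindex_bij_witness[where j = "\<lambda>ws. rev (map g ws)" and i = "\<lambda>ws. rev (map h ws)"])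
    fix ws assume ws: "ws \<in> sorted_chains (length (rev ks)) (h ` B)"
    show "rev (map g ws) \<in> sorted_chains (length ks) B"
      using rev_map_in_sorted_chains[where f = g, OF ws assms(4)] gB by simp
    show hg: "rev (map h (rev (map g ws))) = ws"
      using ws assms(2) by (auto simp: sorted_chains_def rev_map intro!: nth_equalityI map_idI)
    have "chain_term \<phi> (rev ks) ws = chain_term \<phi> (rev ks) (rev (map h (rev (map g ws))))"
      by (simp only: hg)
    also have "\<dots> = chain_term \<phi> ks (map h (rev (map g ws)))"
      using ws by (intro chain_term_rev) (simp add: sorted_chains_def)
    also have "\<dots> = chain_term \<psi> ks (rev (map g ws))"
      unfolding chain_term_map
      unfolding chain_term_def using ws assms(2,3)
      by (intro arg_cong[of _ _ prod_list] map_cong refl) (force simp: sorted_chains_def dest!: set_zip_rightD)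
    finally show "chain_term \<psi> ks (rev (map g ws)) = chain_term \<phi> (rev ks) ws" ..
  next
    fix ws assume ws: "ws \<in> sorted_chains (length ks) B"
    show "rev (map h ws) \<in> sorted_chains (length (rev ks)) (h ` B)"
      using rev_map_in_sorted_chains[where f = h, OF ws assms(1)] by simp
    show "rev (map g (rev (map h ws))) = ws"
      using ws assms(2) by (auto simp: sorted_chains_def rev_map intro!: map_idI)
  qed
qed

text \<open>
A chain through \<open>s\<close> at position \<open>i\<close> is a chain below \<open>s\<close> together with a chain above \<open>s\<close>.
\<close>

lemma sum_chains_split_at:
  fixes S :: "'a::linorder set"
  assumes "finite S" "i < r"
  shows "(\<Sum>ws\<in>sorted_chains r S. g (take i ws) (ws ! i) (drop (Suc i) ws))
    = (\<Sum>s\<in>S. \<Sum>us\<in>sorted_chains i {x\<in>S. x < s}. \<Sum>vs\<in>sorted_chains (r - Suc i) {x\<in>S. s < x}. g us s vs)"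
proof -
  have "(\<Sum>s\<in>S. \<Sum>us\<in>sorted_chains i {x\<in>S. x < s}. \<Sum>vs\<in>sorted_chains (r - Suc i) {x\<in>S. s < x}. g us s vs)
     = (\<Sum>(s, us, vs)\<in>(SIGMA s:S. sorted_chains i {x\<in>S. x < s} \<times> sorted_chains (r - Suc i) {x\<in>S. s < x}). g us s vs)"
    using assms(1) by (simp add: sum.Sigma finite_chains split_beta flip: sum.cartesian_product)
  also have "\<dots> = (\<Sum>ws\<in>sorted_chains r S. g (take i ws) (ws ! i) (drop (Suc i) ws))"
  proof (rule sum.reindex_bij_witness[where j = "\<lambda>(s, us, vs). us @ s # vs" and
        i = "\<lambda>ws. (ws ! i, take i ws, drop (Suc i) ws)"])
    fix ws assume ws: "ws \<in> sorted_chains r S"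
    have eq: "take i ws @ ws ! i # drop (Suc i) ws = ws"
      using ws assms by (intro id_take_nth_drop[symmetric]) (simp add: sorted_chains_def)
    have "sorted_wrt (<) (take i ws @ ws ! i # drop (Suc i) ws)" "set (take i ws @ ws ! i # drop (Suc i) ws) \<subseteq> S"
      unfolding eq using ws by (simp_all add: sorted_chains_def)
    then show "(ws ! i, take i ws, drop (Suc i) ws)
        \<in> (SIGMA s:S. sorted_chains i {x\<in>S. x < s} \<times> sorted_chains (r - Suc i) {x\<in>S. s < x})"
      using ws assms by (auto simp: sorted_chains_def sorted_wrt_append)
    show "(case (ws ! i, take i ws, drop (Suc i) ws) of (s, us, vs) \<Rightarrow> us @ s # vs) = ws"
      using eq by simp
  next
    fix a assume "a \<in> (SIGMA s:S. sorted_chains i {x\<in>S. x < s} \<times> sorted_chains (r - Suc i) {x\<in>S. s < x})"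
    then obtain s us vs where a: "a = (s, us, vs)" "s \<in> S" "us \<in> sorted_chains i {x\<in>S. x < s}"
        "vs \<in> sorted_chains (r - Suc i) {x\<in>S. s < x}"
      by auto
    have [simp]: "length us = i"
      using a by (simp add: sorted_chains_def)
    show "(\<lambda>ws. (ws ! i, take i ws, drop (Suc i) ws)) (case a of (s, us, vs) \<Rightarrow> us @ s # vs) = a"
      by (simp add: a nth_append)
    show "(case a of (s, us, vs) \<Rightarrow> us @ s # vs) \<in> sorted_chains r S"
      using a assms by (auto simp: sorted_chains_def sorted_wrt_append subset_iff intro: less_trans)
    show "g (take i (case a of (s, us, vs) \<Rightarrow> us @ s # vs)) ((case a of (s, us, vs) \<Rightarrow> us @ s # vs) ! i)
            (drop (Suc i) (case a of (s, us, vs) \<Rightarrow> us @ s # vs)) = (case a of (s, us, vs) \<Rightarrow> g us s vs)"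
      by (simp add: a nth_append)
  qed
  finally show ?thesis by simp
qed

text \<open>
If \<open>A\<close> lies below \<open>B\<close>, a chain in the union runs through \<open>A\<close> first and then through \<open>B\<close>,
changing sides at a unique index \<open>j\<close>.
\<close>

lemma chain_sum_Un_finite:
  fixes A B :: "'a::linorder set"
  assumes "finite A" "finite B" and less: "\<And>a b. a \<in> A \<Longrightarrow> b \<in> B \<Longrightarrow> a < b"
  shows "chain_sum \<phi> ks (A \<union> B)
    = (\<Sum>j\<le>length ks. chain_sum \<phi> (take j ks) A * chain_sum \<phi> (drop j ks) B)"
proof -
  define l where "l = length ks"
  have disj: "a \<notin> A" if "a \<in> B" for a
    using less that by blast
  have "(\<Sum>j\<le>l. chain_sum \<phi> (take j ks) A * chain_sum \<phi> (drop j ks) B)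
     = (\<Sum>j\<le>l. \<Sum>us\<in>sorted_chains j A. \<Sum>vs\<in>sorted_chains (l - j) B.
          chain_term \<phi> (take j ks) us * chain_term \<phi> (drop j ks) vs)"
    using assms by (intro sum.cong refl) (simp add: chain_sum_finite sum_product l_def min_def)
  also have "\<dots> = (\<Sum>(j, us, vs)\<in>(SIGMA j:{..l}. sorted_chains j A \<times> sorted_chains (l - j) B).
          chain_term \<phi> (take j ks) us * chain_term \<phi> (drop j ks) vs)"
    using assms by (simp add: sum.Sigma finite_chains split_beta flip: sum.cartesian_product)
  also have "\<dots> = (\<Sum>ws\<in>sorted_chains l (A \<union> B). chain_term \<phi> ks ws)"
  proof (rule sum.reindex_bij_witness[where j = "\<lambda>(j, us, vs). us @ vs" and
        i = "\<lambda>ws. (length (takeWhile (\<lambda>x. x \<in> A) ws), takeWhile (\<lambda>x. x \<in> A) ws, dropWhile (\<lambda>x. x \<in> A) ws)"])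
    fix a assume "a \<in> (SIGMA j:{..l}. sorted_chains j A \<times> sorted_chains (l - j) B)"
    then obtain j us vs where a: "a = (j, us, vs)" "j \<le> l" "us \<in> sorted_chains j A" "vs \<in> sorted_chains (l - j) B"
      by auto
    have us: "length us = j" "\<And>x. x \<in> set us \<Longrightarrow> x \<in> A"
      using a by (auto simp: sorted_chains_def)
    have vs: "takeWhile (\<lambda>x. x \<in> A) vs = []" "dropWhile (\<lambda>x. x \<in> A) vs = vs"
      using a disj by (cases vs; auto simp: sorted_chains_def)+
    show "(\<lambda>ws. (length (takeWhile (\<lambda>x. x \<in> A) ws), takeWhile (\<lambda>x. x \<in> A) ws, dropWhile (\<lambda>x. x \<in> A) ws))
        (case a of (j, us, vs) \<Rightarrow> us @ vs) = a"
      using us vs by (simp add: a)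
    show "(case a of (j, us, vs) \<Rightarrow> us @ vs) \<in> sorted_chains l (A \<union> B)"
      using a less by (auto simp: sorted_chains_def sorted_wrt_append subset_iff)
    have "chain_term \<phi> (take j ks @ drop j ks) (us @ vs) = chain_term \<phi> (take j ks) us * chain_term \<phi> (drop j ks) vs"
      using a us by (intro chain_term_append) (simp add: l_def)
    then show "chain_term \<phi> ks (case a of (j, us, vs) \<Rightarrow> us @ vs)
        = (case a of (j, us, vs) \<Rightarrow> chain_term \<phi> (take j ks) us * chain_term \<phi> (drop j ks) vs)"
      by (simp add: a)
  next
    fix ws assume ws: "ws \<in> sorted_chains l (A \<union> B)"
    define us vs where "us = takeWhile (\<lambda>x. x \<in> A) ws" and "vs = dropWhile (\<lambda>x. x \<in> A) ws"
    have eq: "us @ vs = ws"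
      by (simp add: us_def vs_def)
    have ws': "sorted_wrt (<) (us @ vs)" "set (us @ vs) \<subseteq> A \<union> B" "length (us @ vs) = l"
      unfolding eq using ws by (simp_all add: sorted_chains_def)
    have us: "set us \<subseteq> A"
      by (auto simp: us_def dest: set_takeWhileD)
    have vs: "set vs \<subseteq> B"
    proof (cases vs)
      case (Cons v vs')
      have "v \<notin> A"
        using Cons hd_dropWhile[of "\<lambda>x. x \<in> A" ws] by (simp add: vs_def)
      then have "v \<in> B"
        using ws'(2) Cons by auto
      moreover have "x \<in> B" if "x \<in> set vs'" for x
      proof (rule ccontr)
        assume "x \<notin> B"
        then have "x < v"
          using that Cons ws'(2) less \<open>v \<in> B\<close> by auto
        moreover have "v < x"
          using that Cons ws'(1) by (auto simp: sorted_wrt_append)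
        ultimately show False by simp
      qed
      ultimately show ?thesis
        using Cons by auto
    qed simp
    show "(case (length (takeWhile (\<lambda>x. x \<in> A) ws), takeWhile (\<lambda>x. x \<in> A) ws, dropWhile (\<lambda>x. x \<in> A) ws)
        of (j, us, vs) \<Rightarrow> us @ vs) = ws"
      by simp
    show "(length (takeWhile (\<lambda>x. x \<in> A) ws), takeWhile (\<lambda>x. x \<in> A) ws, dropWhile (\<lambda>x. x \<in> A) ws)
        \<in> (SIGMA j:{..l}. sorted_chains j A \<times> sorted_chains (l - j) B)"
      unfolding us_def[symmetric] vs_def[symmetric]
      using us vs ws' by (auto simp: sorted_chains_def sorted_wrt_append)
  qed
  finally show ?thesis
    using assms by (simp add: chain_sum_finite l_def)
qed

text \<open>
Forgetting the order turns the sum over chains into a product of sums over single points, which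
dominates it.
\<close>

lemma sum_norm_chain_term_le:
  assumes "\<And>k. k \<in> set ks \<Longrightarrow> (\<lambda>w. 1 / norm (\<phi> w) ^ k) summable_on X"
    and "finite F" "F \<subseteq> X"
  shows "(\<Sum>ws | set ws \<subseteq> F \<and> length ws = length ks. norm (chain_term \<phi> ks ws))
    \<le> (\<Prod>k\<leftarrow>ks. \<Sum>\<^sub>\<infinity>w\<in>X. 1 / norm (\<phi> w) ^ k)"
  using assms(1)
proof (induction ks)
  case Nil
  have "{ws. set ws \<subseteq> F \<and> length ws = length ([] :: nat list)} = {[]}"
    by auto
  then show ?case
    by (simp add: chain_term_def)
next
  case (Cons k ks)
  have inj: "inj_on (\<lambda>(ws, w). w # ws) ({ws. set ws \<subseteq> F \<and> length ws = length ks} \<times> F)"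
    by (auto simp: inj_on_def)
  have fin: "finite {ws. set ws \<subseteq> F \<and> length ws = length ks}"
    using finite_lists_length_eq[OF assms(2)] .
  have "(\<Sum>ws | set ws \<subseteq> F \<and> length ws = length (k # ks). norm (chain_term \<phi> (k # ks) ws))
      = (\<Sum>(ws, w)\<in>{ws. set ws \<subseteq> F \<and> length ws = length ks} \<times> F.
          norm (chain_term \<phi> ks ws) * (1 / norm (\<phi> w) ^ k))"
    unfolding list.size add_0_right add_Suc_right lists_length_Suc_eq sum.reindex[OF inj]
    by (intro sum.cong refl) (auto simp: chain_term_def norm_mult norm_divide norm_power)
  also have "\<dots> = (\<Sum>ws | set ws \<subseteq> F \<and> length ws = length ks. norm (chain_term \<phi> ks ws))
      * (\<Sum>w\<in>F. 1 / norm (\<phi> w) ^ k)"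
    by (simp add: sum_product sum.cartesian_product)
  also have "\<dots> \<le> (\<Prod>k\<leftarrow>ks. \<Sum>\<^sub>\<infinity>w\<in>X. 1 / norm (\<phi> w) ^ k) * (\<Sum>\<^sub>\<infinity>w\<in>X. 1 / norm (\<phi> w) ^ k)"
    using Cons assms(2,3)
    by (intro mult_mono finite_sum_le_infsum sum_nonneg prod_list_nonneg infsum_nonneg) (auto intro: infsum_nonneg)
  finally show ?case
    by (simp add: mult.commute)
qed

context
  fixes \<phi> :: "'a::linorder \<Rightarrow> complex" and ks :: "nat list" and X :: "'a set"
  assumes summable: "\<And>k. k \<in> set ks \<Longrightarrow> (\<lambda>w. 1 / norm (\<phi> w) ^ k) summable_on X"
begin

lemma sum_norm_sorted_chains_le:
  assumes "finite G" "G \<subseteq> sorted_chains (length ks) X"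
  shows "(\<Sum>ws\<in>G. norm (chain_term \<phi> ks ws)) \<le> (\<Prod>k\<leftarrow>ks. \<Sum>\<^sub>\<infinity>w\<in>X. 1 / norm (\<phi> w) ^ k)"
proof -
  define F where "F = (\<Union>ws\<in>G. set ws)"
  have F: "finite F" "F \<subseteq> X"
    using assms by (auto simp: F_def sorted_chains_def)
  have "(\<Sum>ws\<in>G. norm (chain_term \<phi> ks ws))
     \<le> (\<Sum>ws | set ws \<subseteq> F \<and> length ws = length ks. norm (chain_term \<phi> ks ws))"
    using assms F by (intro sum_mono2 finite_lists_length_eq) (auto simp: F_def sorted_chains_def)
  also have "\<dots> \<le> (\<Prod>k\<leftarrow>ks. \<Sum>\<^sub>\<infinity>w\<in>X. 1 / norm (\<phi> w) ^ k)"
    by (rule sum_norm_chain_term_le[OF summable F])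
  finally show ?thesis .
qed

lemma chain_term_abs_summable: "chain_term \<phi> ks abs_summable_on sorted_chains (length ks) X"
  by (rule nonneg_bdd_above_summable_on)
    (auto intro!: bdd_aboveI2[OF sum_norm_sorted_chains_le])

lemma norm_chain_sum_le:
  assumes "B \<subseteq> X"
  shows "norm (chain_sum \<phi> ks B) \<le> (\<Prod>k\<leftarrow>ks. \<Sum>\<^sub>\<infinity>w\<in>X. 1 / norm (\<phi> w) ^ k)"
proof -
  have sub: "sorted_chains (length ks) B \<subseteq> sorted_chains (length ks) X"
    by (rule sorted_chains_mono[OF assms])
  have abs: "chain_term \<phi> ks abs_summable_on sorted_chains (length ks) B"
    by (rule summable_on_subset_banach[OF chain_term_abs_summable sub])
  have "norm (chain_sum \<phi> ks B) \<le> (\<Sum>\<^sub>\<infinity>ws\<in>sorted_chains (length ks) B. norm (chain_term \<phi> ks ws))"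
    unfolding chain_sum_def by (rule norm_infsum_bound[OF abs])
  also have "\<dots> \<le> (\<Prod>k\<leftarrow>ks. \<Sum>\<^sub>\<infinity>w\<in>X. 1 / norm (\<phi> w) ^ k)"
    using sub by (intro infsum_le_finite_sums[OF abs] sum_norm_sorted_chains_le) auto
  finally show ?thesis .
qed

text \<open>
Every finite set of chains in \<open>X\<close> lives on a finite set of points, so any exhaustion of \<open>X\<close> by
finite sets also exhausts the chains in \<open>X\<close>.
\<close>

lemma tendsto_chain_sum:
  assumes "filterlim B (finite_subsets_at_top X) \<F>"
  shows "((\<lambda>x. chain_sum \<phi> ks (B x)) \<longlongrightarrow> chain_sum \<phi> ks X) \<F>"
proof -
  have lim: "filterlim (\<lambda>x. sorted_chains (length ks) (B x))
      (finite_subsets_at_top (sorted_chains (length ks) X)) \<F>"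
    unfolding filterlim_finite_subsets_at_top
  proof (intro allI impI)
    fix G assume G: "finite G \<and> G \<subseteq> sorted_chains (length ks) X"
    have "finite (\<Union>ws\<in>G. set ws)" "(\<Union>ws\<in>G. set ws) \<subseteq> X"
      using G by (auto simp: sorted_chains_def)
    then have "\<forall>\<^sub>F x in \<F>. finite (B x) \<and> (\<Union>ws\<in>G. set ws) \<subseteq> B x \<and> B x \<subseteq> X"
      using assms unfolding filterlim_finite_subsets_at_top by blast
    then show "\<forall>\<^sub>F x in \<F>. finite (sorted_chains (length ks) (B x)) \<and> G \<subseteq> sorted_chains (length ks) (B x)
        \<and> sorted_chains (length ks) (B x) \<subseteq> sorted_chains (length ks) X"
    proof eventually_elim
      case (elim x)
      have "G \<subseteq> sorted_chains (length ks) (B x)"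
        using G elim by (fastforce simp: sorted_chains_def)
      then show ?case
        using elim by (simp add: finite_chains sorted_chains_mono)
    qed
  qed
  have "(sum (chain_term \<phi> ks) \<longlongrightarrow> chain_sum \<phi> ks X) (finite_subsets_at_top (sorted_chains (length ks) X))"
    using has_sum_infsum[OF abs_summable_summable[OF chain_term_abs_summable]]
    by (simp add: has_sum_def chain_sum_def)
  from filterlim_compose[OF this lim]
  have "((\<lambda>x. sum (chain_term \<phi> ks) (sorted_chains (length ks) (B x))) \<longlongrightarrow> chain_sum \<phi> ks X) \<F>" .
  moreover have "\<forall>\<^sub>F x in \<F>. sum (chain_term \<phi> ks) (sorted_chains (length ks) (B x)) = chain_sum \<phi> ks (B x)"
  proof -
    have "\<forall>\<^sub>F x in \<F>. finite (B x)"
      using assms unfolding filterlim_finite_subsets_at_top by (auto elim!: allE[of _ "{}"] eventually_mono)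
    then show ?thesis
      by eventually_elim (simp add: chain_sum_finite)
  qed
  ultimately show ?thesis
    by (rule Lim_transform_eventually)
qed

end

lemma chain_sum_Un:
  fixes A B :: "'a::linorder set"
  assumes summable: "\<And>k. k \<in> set ks \<Longrightarrow> (\<lambda>w. 1 / norm (\<phi> w) ^ k) summable_on (A \<union> B)"
    and less: "\<And>a b. a \<in> A \<Longrightarrow> b \<in> B \<Longrightarrow> a < b"
  shows "chain_sum \<phi> ks (A \<union> B)
    = (\<Sum>j\<le>length ks. chain_sum \<phi> (take j ks) A * chain_sum \<phi> (drop j ks) B)"
proof (rule tendsto_unique)
  let ?F = "finite_subsets_at_top (A \<union> B)"
  have restrict: "filterlim (\<lambda>F. F \<inter> C) (finite_subsets_at_top C) ?F" if "C \<subseteq> A \<union> B" for C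
    unfolding filterlim_finite_subsets_at_top eventually_finite_subsets_at_top using that by blast
  have summableA: "(\<lambda>w. 1 / norm (\<phi> w) ^ k) summable_on A"
    and summableB: "(\<lambda>w. 1 / norm (\<phi> w) ^ k) summable_on B" if "k \<in> set ks" for k
    using summable_on_subset_banach[OF summable[OF that]] by blast+
  show "?F \<noteq> bot"
    by simp
  show "(chain_sum \<phi> ks \<longlongrightarrow> chain_sum \<phi> ks (A \<union> B)) ?F"
    using tendsto_chain_sum[OF summable filterlim_ident] .
  have "((\<lambda>F. \<Sum>j\<le>length ks. chain_sum \<phi> (take j ks) (F \<inter> A) * chain_sum \<phi> (drop j ks) (F \<inter> B))
      \<longlongrightarrow> (\<Sum>j\<le>length ks. chain_sum \<phi> (take j ks) A * chain_sum \<phi> (drop j ks) B)) ?F"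
    by (intro tendsto_sum tendsto_mult tendsto_chain_sum restrict summableA summableB)
      (auto dest: in_set_takeD in_set_dropD)
  moreover have "\<forall>\<^sub>F F in ?F. (\<Sum>j\<le>length ks. chain_sum \<phi> (take j ks) (F \<inter> A) * chain_sum \<phi> (drop j ks) (F \<inter> B))
      = chain_sum \<phi> ks F"
  proof (rule eventually_finite_subsets_at_top_weakI)
    fix F assume F: "finite F" "F \<subseteq> A \<union> B"
    have "F = (F \<inter> A) \<union> (F \<inter> B)"
      using F by blast
    then show "(\<Sum>j\<le>length ks. chain_sum \<phi> (take j ks) (F \<inter> A) * chain_sum \<phi> (drop j ks) (F \<inter> B))
        = chain_sum \<phi> ks F"
      using chain_sum_Un_finite[of "F \<inter> A" "F \<inter> B" \<phi> ks] F less by simp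
  qed
  ultimately show "(chain_sum \<phi> ks
      \<longlongrightarrow> (\<Sum>j\<le>length ks. chain_sum \<phi> (take j ks) A * chain_sum \<phi> (drop j ks) B)) ?F"
    by (rule Lim_transform_eventually)
qed

section \<open>Convergence over the rows of a lattice\<close>

text \<open>
Lattice points are handled through their coordinate pairs, on which the order of the lattice is
the lexicographic order of the product type.
\<close>

definition lattice_point :: "complex \<Rightarrow> int \<times> int \<Rightarrow> complex" where
  "lattice_point \<tau> = (\<lambda>(m, n). of_int m * \<tau> + of_int n)"

definition strip :: "nat \<Rightarrow> (int \<times> int) set" where
  "strip M = {p. (0, 0) < p \<and> fst p \<le> int M}"

definition row :: "nat \<Rightarrow> (int \<times> int) set" where
  "row m = {int m} \<times> UNIV"

lemma filterlim_window:
  fixes X :: "(int \<times> int) set"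
  assumes "\<And>c d. finite {p \<in> X. - int c \<le> snd p \<and> snd p \<le> int d}"
    and "filterlim c sequentially \<F>" "filterlim d sequentially \<F>"
  shows "filterlim (\<lambda>x. {p \<in> X. - int (c x) \<le> snd p \<and> snd p \<le> int (d x)}) (finite_subsets_at_top X) \<F>"
  unfolding filterlim_finite_subsets_at_top
proof (intro allI impI)
  fix Y assume Y: "finite Y \<and> Y \<subseteq> X"
  define N where "N = nat (Max (insert 0 ((\<lambda>p. \<bar>snd p\<bar>) ` Y)))"
  have N: "\<bar>snd p\<bar> \<le> int N" if "p \<in> Y" for p
  proof -
    have "\<bar>snd p\<bar> \<le> Max (insert 0 ((\<lambda>p. \<bar>snd p\<bar>) ` Y))"
      using Y that by (intro Max_ge) auto
    then show ?thesis unfolding N_def by linarith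
  qed
  have "\<forall>\<^sub>F x in \<F>. N \<le> c x" "\<forall>\<^sub>F x in \<F>. N \<le> d x"
    using assms(2,3) by (auto simp: filterlim_at_top)
  then show "\<forall>\<^sub>F x in \<F>. finite {p \<in> X. - int (c x) \<le> snd p \<and> snd p \<le> int (d x)}
      \<and> Y \<subseteq> {p \<in> X. - int (c x) \<le> snd p \<and> snd p \<le> int (d x)}
      \<and> {p \<in> X. - int (c x) \<le> snd p \<and> snd p \<le> int (d x)} \<subseteq> X"
  proof eventually_elim
    case (elim x)
    have "- int (c x) \<le> snd p \<and> snd p \<le> int (d x)" if "p \<in> Y" for p
      using N[OF that] elim by auto
    then show ?case
      using assms(1) Y by blast
  qed
qed

lemma sum_inverse_squares_le:
  fixes a :: real
  assumes "a \<ge> 1" "finite F"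
  shows "(\<Sum>n\<in>F. 1 / (a + real_of_int \<bar>n\<bar>)\<^sup>2) \<le> 3 / a"
proof -
  have step: "1 / (b + 1)\<^sup>2 \<le> 1 / b - 1 / (b + 1)" if "b \<ge> 1" for b :: real
  proof -
    have "1 / b - 1 / (b + 1) = 1 / (b * (b + 1))"
      using that by (simp add: field_simps)
    moreover have "1 / (b + 1)\<^sup>2 \<le> 1 / (b * (b + 1))"
      using that unfolding power2_eq_square by (intro divide_left_mono mult_right_mono mult_pos_pos) auto
    ultimately show ?thesis
      by simp
  qed
  have "(\<Sum>n=-int N..int N. 1 / (a + real_of_int \<bar>n\<bar>)\<^sup>2) \<le> 1 / a\<^sup>2 + 2 * (1 / a - 1 / (a + real N))" for N
  proof (induction N)
    case (Suc N)
    have "{-int (Suc N)..int (Suc N)} = insert (-int (Suc N)) (insert (int (Suc N)) {-int N..int N})"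
      by auto
    then have "(\<Sum>n=-int (Suc N)..int (Suc N). 1 / (a + real_of_int \<bar>n\<bar>)\<^sup>2)
       = 2 * (1 / ((a + real N) + 1)\<^sup>2) + (\<Sum>n=-int N..int N. 1 / (a + real_of_int \<bar>n\<bar>)\<^sup>2)"
      by (simp add: add_ac)
    also have "\<dots> \<le> 2 * (1 / (a + real N) - 1 / (a + real N + 1)) + (1 / a\<^sup>2 + 2 * (1 / a - 1 / (a + real N)))"
      using Suc step[of "a + real N"] assms by (intro add_mono mult_left_mono) auto
    finally show ?case
      by (simp add: algebra_simps)
  qed simp
  moreover have "1 / a\<^sup>2 + 2 * (1 / a - 1 / (a + real N)) \<le> 3 / a" for N
  proof -
    have "1 / a\<^sup>2 \<le> 1 / a" "1 / (a + real N) \<ge> 0"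
      using assms by (auto simp: field_simps power2_eq_square)
    moreover have "3 / a = 1 / a + 2 * (1 / a)"
      by simp
    ultimately show ?thesis
      by argo
  qed
  ultimately have bound: "(\<Sum>n=-int N..int N. 1 / (a + real_of_int \<bar>n\<bar>)\<^sup>2) \<le> 3 / a" for N
    by (rule order_trans)
  define N where "N = nat (Max (insert 0 (abs ` F)))"
  have "F \<subseteq> {-int N..int N}"
  proof
    fix n assume "n \<in> F"
    then have "\<bar>n\<bar> \<le> Max (insert 0 (abs ` F))"
      using assms by (intro Max_ge) auto
    then show "n \<in> {-int N..int N}"
      by (auto simp: N_def)
  qed
  then have "(\<Sum>n\<in>F. 1 / (a + real_of_int \<bar>n\<bar>)\<^sup>2) \<le> (\<Sum>n=-int N..int N. 1 / (a + real_of_int \<bar>n\<bar>)\<^sup>2)"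
    by (intro sum_mono2) auto
  then show ?thesis
    using bound order_trans by blast
qed

lemma sum_telescope_int:
  fixes f :: "int \<Rightarrow> 'a::ab_group_add"
  shows "(\<Sum>n=-int N..int N. f n - f (n + 1)) = f (-int N) - f (int N + 1)"
proof (induction N)
  case (Suc N)
  have "{-int (Suc N)..int (Suc N)} = insert (-int (Suc N)) (insert (int (Suc N)) {-int N..int N})"
    by auto
  moreover have "- int (Suc N) + 1 = - int N"
    by simp
  ultimately show ?case
    using Suc by (simp add: add_ac)
qed simp

context
  fixes \<tau> :: complex
  assumes Im_pos: "Im \<tau> > 0"
begin

text \<open>
The shift by \<open>\<lfloor>m * Re \<tau>\<rfloor>\<close> removes the skewness of the lattice: up to a constant, the norms in
row \<open>m\<close> are those of the rectangular lattice, uniformly in \<open>m\<close>.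
\<close>

lemma norm_lattice_point_ge:
  assumes "m \<ge> 1"
  shows "real m * Im \<tau> \<le> norm (lattice_point \<tau> (int m, n))"
    and "real m + real_of_int \<bar>n + \<lfloor>real m * Re \<tau>\<rfloor>\<bar> \<le> (1 + 2 / Im \<tau>) * norm (lattice_point \<tau> (int m, n))"
proof -
  let ?w = "lattice_point \<tau> (int m, n)"
  have re: "Re ?w = real m * Re \<tau> + real_of_int n" and im: "Im ?w = real m * Im \<tau>"
    by (simp_all add: lattice_point_def)
  show 1: "real m * Im \<tau> \<le> norm ?w"
    using abs_Im_le_cmod[of ?w] im Im_pos by simp
  have "real_of_int \<bar>n + \<lfloor>real m * Re \<tau>\<rfloor>\<bar> \<le> \<bar>Re ?w\<bar> + 1"
    unfolding re by linarith
  also have "\<dots> \<le> norm ?w + real m"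
    using abs_Re_le_cmod[of ?w] assms by simp
  finally have "real m + real_of_int \<bar>n + \<lfloor>real m * Re \<tau>\<rfloor>\<bar> \<le> norm ?w + 2 * real m"
    by simp
  also have "real m \<le> norm ?w / Im \<tau>"
    using 1 Im_pos by (simp add: field_simps)
  finally show "real m + real_of_int \<bar>n + \<lfloor>real m * Re \<tau>\<rfloor>\<bar> \<le> (1 + 2 / Im \<tau>) * norm ?w"
    by (simp add: algebra_simps)
qed

definition row_const :: real where
  "row_const = 3 * (1 + 2 / Im \<tau>)\<^sup>2"

lemma sum_row_squares_le:
  assumes "m \<ge> 1" "finite F" "F \<subseteq> row m"
  shows "(\<Sum>p\<in>F. 1 / norm (lattice_point \<tau> p) ^ 2) \<le> row_const / real m"
proof -
  define s where "s = \<lfloor>real m * Re \<tau>\<rfloor>"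
  have "1 / norm (lattice_point \<tau> p) ^ 2 \<le> (1 + 2 / Im \<tau>)\<^sup>2 * (1 / (real m + real_of_int \<bar>snd p + s\<bar>)\<^sup>2)"
    if "p \<in> F" for p
  proof -
    have p: "p = (int m, snd p)"
      using that assms by (auto simp: row_def)
    have pos: "0 < real m + real_of_int \<bar>snd p + s\<bar>"
      using assms by simp
    have le: "real m + real_of_int \<bar>snd p + s\<bar> \<le> (1 + 2 / Im \<tau>) * norm (lattice_point \<tau> p)"
      using norm_lattice_point_ge(2)[OF assms(1), of "snd p"] p by (simp add: s_def)
    then have "(real m + real_of_int \<bar>snd p + s\<bar>)\<^sup>2 \<le> (1 + 2 / Im \<tau>)\<^sup>2 * norm (lattice_point \<tau> p) ^ 2"
      unfolding power_mult_distrib[symmetric] using pos by (intro power_mono) auto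
    moreover have "norm (lattice_point \<tau> p) > 0"
      using le pos by (cases "lattice_point \<tau> p = 0") auto
    ultimately show ?thesis
      using pos by (simp add: field_simps)
  qed
  then have "(\<Sum>p\<in>F. 1 / norm (lattice_point \<tau> p) ^ 2)
      \<le> (1 + 2 / Im \<tau>)\<^sup>2 * (\<Sum>p\<in>F. 1 / (real m + real_of_int \<bar>snd p + s\<bar>)\<^sup>2)"
    unfolding sum_distrib_left by (rule sum_mono)
  also have "(\<Sum>p\<in>F. 1 / (real m + real_of_int \<bar>snd p + s\<bar>)\<^sup>2)
      = (\<Sum>n\<in>(\<lambda>p. snd p + s) ` F. 1 / (real m + real_of_int \<bar>n\<bar>)\<^sup>2)"
    using assms(3) by (subst sum.reindex) (auto simp: inj_on_def row_def)
  also have "(1 + 2 / Im \<tau>)\<^sup>2 * \<dots> \<le> (1 + 2 / Im \<tau>)\<^sup>2 * (3 / real m)"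
    using assms by (intro mult_left_mono sum_inverse_squares_le) auto
  finally show ?thesis
    by (simp add: row_const_def mult.commute)
qed

text \<open>
All points of row \<open>m\<close> have norm at least \<open>m * Im \<tau>\<close>, so each exponent above \<open>2\<close> gains another
factor \<open>1 / m\<close> over the sum of inverse squares.
\<close>

lemma row_summable_bound:
  assumes "m \<ge> 1" "k \<ge> 2"
  shows "(\<lambda>p. 1 / norm (lattice_point \<tau> p) ^ k) summable_on row m"
    and "(\<Sum>\<^sub>\<infinity>p\<in>row m. 1 / norm (lattice_point \<tau> p) ^ k) \<le> row_const / Im \<tau> ^ (k - 2) / real m ^ (k - 1)"
proof -
  have fin: "(\<Sum>p\<in>F. 1 / norm (lattice_point \<tau> p) ^ k) \<le> row_const / Im \<tau> ^ (k - 2) / real m ^ (k - 1)"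
    if F: "finite F" "F \<subseteq> row m" for F
  proof -
    have pos: "0 < real m * Im \<tau>"
      using assms Im_pos by simp
    have k: "k = 2 + (k - 2)" "k - 1 = Suc (k - 2)"
      using assms by auto
    have "1 / norm (lattice_point \<tau> p) ^ k \<le> 1 / norm (lattice_point \<tau> p) ^ 2 * (1 / (real m * Im \<tau>) ^ (k - 2))"
      if p: "p \<in> F" for p
    proof -
      have "p = (int m, snd p)"
        using p F by (auto simp: row_def)
      then have "real m * Im \<tau> \<le> norm (lattice_point \<tau> p)"
        using norm_lattice_point_ge(1)[OF assms(1), of "snd p"] by simp
      moreover from this have "0 < norm (lattice_point \<tau> p)"
        using pos by (rule less_le_trans[rotated])
      ultimately have "1 / norm (lattice_point \<tau> p) ^ (k - 2) \<le> 1 / (real m * Im \<tau>) ^ (k - 2)"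
        using pos assms(1) Im_pos by (intro divide_left_mono power_mono mult_pos_pos zero_less_power) auto
      then have "1 / norm (lattice_point \<tau> p) ^ 2 * (1 / norm (lattice_point \<tau> p) ^ (k - 2))
          \<le> 1 / norm (lattice_point \<tau> p) ^ 2 * (1 / (real m * Im \<tau>) ^ (k - 2))"
        by (intro mult_left_mono) auto
      moreover have "1 / norm (lattice_point \<tau> p) ^ 2 * (1 / norm (lattice_point \<tau> p) ^ (k - 2)) = 1 / norm (lattice_point \<tau> p) ^ k"
        using arg_cong[OF k(1), of "\<lambda>j. norm (lattice_point \<tau> p) ^ j"] by (simp only: power_add) simp
      ultimately show ?thesis
        by simp
    qed
    then have "(\<Sum>p\<in>F. 1 / norm (lattice_point \<tau> p) ^ k)
        \<le> (\<Sum>p\<in>F. 1 / norm (lattice_point \<tau> p) ^ 2) * (1 / (real m * Im \<tau>) ^ (k - 2))"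
      unfolding sum_distrib_right by (rule sum_mono)
    also have "\<dots> \<le> row_const / real m * (1 / (real m * Im \<tau>) ^ (k - 2))"
      using sum_row_squares_le[OF assms(1) F] pos by (intro mult_right_mono) auto
    also have "\<dots> = row_const / Im \<tau> ^ (k - 2) / real m ^ (k - 1)"
      unfolding k(2) by (simp add: power_mult_distrib field_simps)
    finally show ?thesis .
  qed
  show summable: "(\<lambda>p. 1 / norm (lattice_point \<tau> p) ^ k) summable_on row m"
    by (rule nonneg_bdd_above_summable_on) (auto intro!: bdd_aboveI2[OF fin])
  show "(\<Sum>\<^sub>\<infinity>p\<in>row m. 1 / norm (lattice_point \<tau> p) ^ k) \<le> row_const / Im \<tau> ^ (k - 2) / real m ^ (k - 1)"
    by (rule infsum_le_finite_sums[OF summable fin])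
qed

lemma strip_Suc: "strip (Suc M) = strip M \<union> row (Suc M)"
  by (auto simp: strip_def row_def)

lemma strip_summable:
  assumes "k \<ge> 2"
  shows "(\<lambda>p. 1 / norm (lattice_point \<tau> p) ^ k) summable_on strip M"
proof (induction M)
  case 0
  \<comment> \<open>The bottom row consists of the positive integers \<open>n = 1 + (n - 1)\<close>.\<close>
  have fin: "(\<Sum>p\<in>F. 1 / norm (lattice_point \<tau> p) ^ k) \<le> 3" if F: "finite F" "F \<subseteq> strip 0" for F
  proof -
    have "1 / norm (lattice_point \<tau> p) ^ k \<le> 1 / (1 + real_of_int \<bar>snd p - 1\<bar>)\<^sup>2" if p: "p \<in> F" for p
    proof -
      obtain n where n: "p = (0, n)" "n \<ge> 1"
        using p F by (cases p) (auto simp: strip_def)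
      have "real_of_int n ^ 2 \<le> real_of_int n ^ k"
        using n assms by (intro power_increasing) auto
      then show ?thesis
        using n by (auto simp: lattice_point_def intro!: divide_left_mono)
    qed
    then have "(\<Sum>p\<in>F. 1 / norm (lattice_point \<tau> p) ^ k) \<le> (\<Sum>p\<in>F. 1 / (1 + real_of_int \<bar>snd p - 1\<bar>)\<^sup>2)"
      by (rule sum_mono)
    also have "\<dots> = (\<Sum>n\<in>(\<lambda>p. snd p - 1) ` F. 1 / (1 + real_of_int \<bar>n\<bar>)\<^sup>2)"
    proof -
      have "fst p = 0" if "p \<in> F" for p
        using F that by (auto simp: strip_def less_prod_def')
      then have "inj_on (\<lambda>p. snd p - 1) F"
        by (intro inj_onI prod_eqI) auto
      then show ?thesis
        by (simp add: sum.reindex)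
    qed
    also have "\<dots> \<le> 3"
      using F sum_inverse_squares_le[of 1 "(\<lambda>p. snd p - 1) ` F"] by simp
    finally show ?thesis .
  qed
  show ?case
    by (rule nonneg_bdd_above_summable_on) (auto intro!: bdd_aboveI2[OF fin])
next
  case (Suc M)
  then show ?case
    unfolding strip_Suc using row_summable_bound(1)[of "Suc M" k] assms
    by (intro summable_on_union) auto
qed

text \<open>
For the single exponent \<open>2\<close> the absolute values only give \<open>O(1 / m)\<close>. Subtracting the
telescoping series of \<open>1 / w - 1 / (w + 1)\<close>, which sums to zero along the row, replaces
\<open>1 / w ^ 2\<close> by \<open>1 / (w ^ 2 * (w + 1))\<close> and gains the missing factor.
\<close>

lemma chain_sum_singleton_row_bound:
  assumes "m \<ge> 1"
  shows "norm (chain_sum (lattice_point \<tau>) [2] (row m)) \<le> row_const / Im \<tau> / real m ^ 2"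
proof -
  define z where "z = of_int (int m) * \<tau>"
  define B where "B N = {int m} \<times> {-int N..int N}" for N
  have pos: "real m * Im \<tau> > 0"
    using assms Im_pos by simp
  have lp: "lattice_point \<tau> (int m, n) = z + of_int n" for n
    by (simp add: lattice_point_def z_def)
  have ge: "real m * Im \<tau> \<le> norm (z + of_int n)" for n
    using norm_lattice_point_ge(1)[OF assms, of n] lp by simp
  then have nz: "z + of_int n \<noteq> 0" for n
    using pos by (metis norm_zero not_less)
  have B: "B N = {p \<in> row m. - int N \<le> snd p \<and> snd p \<le> int N}" for N
    by (auto simp: B_def row_def)
  have lim: "filterlim B (finite_subsets_at_top (row m)) sequentially"
    unfolding B
  proof (rule filterlim_window)
    fix c d
    show "finite {p \<in> row m. - int c \<le> snd p \<and> snd p \<le> int d}"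
      by (rule finite_subset[of _ "{int m} \<times> {- int c..int d}"]) (auto simp: row_def)
  qed (rule filterlim_ident)+
  have summable2: "(\<lambda>p. 1 / norm (lattice_point \<tau> p) ^ k) summable_on row m" if "k \<in> set [2]" for k
    using row_summable_bound(1)[OF assms] that by simp
  have finite_le: "norm (chain_sum (lattice_point \<tau>) [2] (B N))
      \<le> row_const / Im \<tau> / real m ^ 2 + (norm (1 / (- z + of_nat N)) + norm (1 / ((z + 1) + of_nat N)))" for N
  proof -
    have chains1: "sorted_chains (Suc 0) B' = (\<lambda>n. [n]) ` B'" for B' :: "(int \<times> int) set"
      by (auto simp: sorted_chains_def length_Suc_conv)
    have "chain_sum (lattice_point \<tau>) [2] (B N) = (\<Sum>p\<in>B N. 1 / lattice_point \<tau> p ^ 2)"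
      by (subst chain_sum_finite) (auto simp: B_def chains1 sum.reindex inj_on_def chain_term_def)
    also have "\<dots> = (\<Sum>n=-int N..int N. 1 / (z + of_int n) ^ 2)"
      by (rule sum.reindex_bij_witness[where j = snd and i = "\<lambda>n. (int m, n)"]) (auto simp: B_def lp)
    also have "\<dots> = (\<Sum>n=-int N..int N. 1 / ((z + of_int n) ^ 2 * (z + of_int (n + 1))))
        + (\<Sum>n=-int N..int N. 1 / (z + of_int n) - 1 / (z + of_int (n + 1)))"
    proof -
      have decomp: "1 / a ^ 2 = 1 / (a ^ 2 * b) + (1 / a - 1 / b)" if "a \<noteq> 0" "b \<noteq> 0" "b = a + 1" for a b :: complex
        using that(1,2) unfolding that(3) by (simp add: divide_simps) (simp add: power2_eq_square algebra_simps)
      have "1 / (z + of_int n) ^ 2 = 1 / ((z + of_int n) ^ 2 * (z + of_int (n + 1)))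
          + (1 / (z + of_int n) - 1 / (z + of_int (n + 1)))" for n
        by (rule decomp[OF nz nz]) simp
      then show ?thesis
        unfolding sum.distrib[symmetric] by (intro sum.cong refl)
    qed
    also have "(\<Sum>n=-int N..int N. 1 / (z + of_int n) - 1 / (z + of_int (n + 1)))
        = - (1 / (- z + of_nat N)) - 1 / ((z + 1) + of_nat N)"
    proof -
      have "z + of_int (- int N) = - (- z + of_nat N)" "z + of_int (int N + 1) = (z + 1) + of_nat N"
        by simp_all
      then show ?thesis
        using sum_telescope_int[of "\<lambda>n. 1 / (z + of_int n)" N] by (simp only: divide_minus_right)
    qed
    finally have "norm (chain_sum (lattice_point \<tau>) [2] (B N))
      \<le> norm (\<Sum>n=-int N..int N. 1 / ((z + of_int n) ^ 2 * (z + of_int (n + 1))))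
        + (norm (1 / (- z + of_nat N)) + norm (1 / ((z + 1) + of_nat N)))"
      by (simp only:) (intro order_trans[OF norm_triangle_ineq] add_mono order_refl
          order_trans[OF norm_triangle_ineq4], simp)
    also have "norm (\<Sum>n=-int N..int N. 1 / ((z + of_int n) ^ 2 * (z + of_int (n + 1))))
       \<le> (\<Sum>n=-int N..int N. 1 / norm (z + of_int n) ^ 2 * (1 / (real m * Im \<tau>)))"
    proof (rule sum_norm_le)
      fix n :: int
      have "1 / norm (z + of_int (n + 1)) \<le> 1 / (real m * Im \<tau>)"
        using ge[of "n + 1"] pos nz[of "n + 1"] by (intro divide_left_mono mult_pos_pos[OF pos]) auto
      then have "1 / norm (z + of_int n) ^ 2 * (1 / norm (z + of_int (n + 1)))
          \<le> 1 / norm (z + of_int n) ^ 2 * (1 / (real m * Im \<tau>))"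
        by (intro mult_left_mono) auto
      then show "norm (1 / ((z + of_int n) ^ 2 * (z + of_int (n + 1))))
          \<le> 1 / norm (z + of_int n) ^ 2 * (1 / (real m * Im \<tau>))"
        by (simp add: norm_divide norm_mult norm_power)
    qed
    also have "\<dots> = (\<Sum>p\<in>B N. 1 / norm (lattice_point \<tau> p) ^ 2) * (1 / (real m * Im \<tau>))"
      unfolding sum_distrib_right
      by (rule sum.reindex_bij_witness[where i = snd and j = "\<lambda>n. (int m, n)"]) (auto simp: B_def lp)
    also have "\<dots> \<le> row_const / real m * (1 / (real m * Im \<tau>))"
      using pos by (intro mult_right_mono sum_row_squares_le[OF assms]) (auto simp: B_def row_def)
    also have "\<dots> = row_const / Im \<tau> / real m ^ 2"
      by (simp add: power2_eq_square mult_ac)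
    finally show ?thesis
      by simp
  qed
  have vanish: "(\<lambda>N. norm (1 / (c + of_nat N :: complex))) \<longlonglongrightarrow> 0" for c
  proof -
    have "filterlim (\<lambda>N. c + of_nat N) at_infinity sequentially"
      by (rule tendsto_add_filterlim_at_infinity[OF tendsto_const tendsto_of_nat])
    then have "(\<lambda>N. inverse (c + of_nat N)) \<longlonglongrightarrow> 0"
      by (rule filterlim_compose[OF tendsto_inverse_0])
    then show ?thesis
      by (simp add: divide_inverse tendsto_norm_zero)
  qed
  have "(\<lambda>N. row_const / Im \<tau> / real m ^ 2 + (norm (1 / (- z + of_nat N)) + norm (1 / ((z + 1) + of_nat N))))
      \<longlonglongrightarrow> row_const / Im \<tau> / real m ^ 2 + (0 + 0)"
    by (intro tendsto_add tendsto_const vanish)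
  moreover have "(\<lambda>N. norm (chain_sum (lattice_point \<tau>) [2] (B N)))
      \<longlonglongrightarrow> norm (chain_sum (lattice_point \<tau>) [2] (row m))"
    by (intro tendsto_norm tendsto_chain_sum[OF summable2 lim])
  ultimately have "norm (chain_sum (lattice_point \<tau>) [2] (row m)) \<le> row_const / Im \<tau> / real m ^ 2 + (0 + 0)"
    using finite_le by (intro tendsto_le[OF sequentially_bot]) (auto intro: always_eventually)
  then show ?thesis
    by simp
qed

text \<open>
An exponent \<open>k\<close> contributes a factor \<open>O(1 / m ^ (k - 1))\<close>; the exponents of these factors add
up to at least \<open>2\<close> unless the word is the single exponent \<open>2\<close>.
\<close>

lemma chain_sum_row_bound:
  assumes "ks \<noteq> []" "\<And>k. k \<in> set ks \<Longrightarrow> k \<ge> 2"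
  obtains C where "\<And>m. m \<ge> 1 \<Longrightarrow> norm (chain_sum (lattice_point \<tau>) ks (row m)) \<le> C / real m ^ 2"
proof (cases "ks = [2]")
  case True
  then show ?thesis
    using chain_sum_singleton_row_bound that by blast
next
  case False
  define D where "D = (\<Prod>k\<leftarrow>ks. row_const / Im \<tau> ^ (k - 2))"
  have D0: "0 \<le> (\<Prod>k\<leftarrow>ls. row_const / Im \<tau> ^ (k - 2))" for ls
    using Im_pos by (intro prod_list_nonneg) (auto simp: row_const_def)
  have exp: "2 \<le> (\<Sum>k\<leftarrow>ks. k - 1)"
  proof -
    obtain a ls where ks: "ks = a # ls"
      using assms by (cases ks) auto
    have "a \<ge> 2"
      using assms(2) ks by simp
    show ?thesis
    proof (cases ls)
      case Nil
      then show ?thesis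
        using False ks \<open>a \<ge> 2\<close> by auto
    next
      case (Cons b ls')
      then have "b \<ge> 2"
        using assms(2) ks by simp
      then show ?thesis
        using Cons ks \<open>a \<ge> 2\<close> by simp
    qed
  qed
  show ?thesis
  proof (rule that)
    fix m :: nat assume m: "m \<ge> 1"
    have "(\<Prod>k\<leftarrow>ls. \<Sum>\<^sub>\<infinity>w\<in>row m. 1 / norm (lattice_point \<tau> w) ^ k)
        \<le> (\<Prod>k\<leftarrow>ls. row_const / Im \<tau> ^ (k - 2)) / real m ^ (\<Sum>k\<leftarrow>ls. k - 1)"
      if "set ls \<subseteq> set ks" for ls
      using that
    proof (induction ls)
      case (Cons k ls)
      have "(\<Prod>k\<leftarrow>k # ls. \<Sum>\<^sub>\<infinity>w\<in>row m. 1 / norm (lattice_point \<tau> w) ^ k)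
         = (\<Sum>\<^sub>\<infinity>w\<in>row m. 1 / norm (lattice_point \<tau> w) ^ k) * (\<Prod>k\<leftarrow>ls. \<Sum>\<^sub>\<infinity>w\<in>row m. 1 / norm (lattice_point \<tau> w) ^ k)"
        by simp
      also have "\<dots> \<le> row_const / Im \<tau> ^ (k - 2) / real m ^ (k - 1)
          * ((\<Prod>k\<leftarrow>ls. row_const / Im \<tau> ^ (k - 2)) / real m ^ (\<Sum>k\<leftarrow>ls. k - 1))"
        using Cons row_summable_bound(2)[OF m, of k] assms(2)[of k] Im_pos
        by (intro mult_mono prod_list_nonneg) (auto simp: row_const_def intro: infsum_nonneg)
      finally show ?case
        by (simp add: power_add)
    qed simp
    from this[OF order_refl] have "norm (chain_sum (lattice_point \<tau>) ks (row m)) \<le> D / real m ^ (\<Sum>k\<leftarrow>ks. k - 1)"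
      unfolding D_def by (intro order_trans[OF norm_chain_sum_le[of ks _ "row m"]] row_summable_bound(1)[OF m] assms(2)) auto
    also have "\<dots> \<le> D / real m ^ 2"
      using D0[of ks] exp m unfolding D_def[symmetric]
      by (intro divide_left_mono power_increasing) auto
    finally show "norm (chain_sum (lattice_point \<tau>) ks (row m)) \<le> D / real m ^ 2" .
  qed
qed

text \<open>
A new row contributes chains that end in it. Splitting each of them at its entrance into the row
gives a bounded sum over a shorter word times a row sum of order \<open>1 / m ^ 2\<close>, so the increments are
summable although the series over the half plane need not converge absolutely.
\<close>

lemma convergent_chain_sum_strip:
  assumes "\<And>k. k \<in> set ks \<Longrightarrow> k \<ge> 2"
  shows "convergent (\<lambda>M. chain_sum (lattice_point \<tau>) ks (strip M))"
  using assms
proof (induction "length ks" arbitrary: ks rule: less_induct)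
  case less
  define L where "L ls M = chain_sum (lattice_point \<tau>) ls (strip M)" for ls M
  define T where "T ls M = chain_sum (lattice_point \<tau>) ls (row M)" for ls M
  have step: "L ks (Suc M) - L ks M = (\<Sum>j<length ks. L (take j ks) M * T (drop j ks) (Suc M))" for M
  proof -
    have "L ks (Suc M) = (\<Sum>j\<le>length ks. L (take j ks) M * T (drop j ks) (Suc M))"
      unfolding L_def T_def strip_Suc
    proof (rule chain_sum_Un)
      fix k assume "k \<in> set ks"
      then show "(\<lambda>w. 1 / norm (lattice_point \<tau> w) ^ k) summable_on strip M \<union> row (Suc M)"
        using strip_summable[of k "Suc M"] less.prems by (simp add: strip_Suc)
    qed (auto simp: strip_def row_def)
    then show ?thesis
      by (simp add: lessThan_Suc_atMost[symmetric] T_def)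
  qed
  have "summable (\<lambda>M. L (take j ks) M * T (drop j ks) (Suc M))" if j: "j < length ks" for j
  proof -
    have "convergent (L (take j ks))"
      unfolding L_def using less.prems j by (intro less.hyps) (auto dest: in_set_takeD)
    then obtain K where K: "\<And>M. norm (L (take j ks) M) \<le> K" "K > 0"
      using convergent_imp_Bseq BseqE by metis
    obtain C where C: "\<And>m. m \<ge> 1 \<Longrightarrow> norm (T (drop j ks) m) \<le> C / real m ^ 2"
    proof -
      have "drop j ks \<noteq> []" "\<And>k. k \<in> set (drop j ks) \<Longrightarrow> k \<ge> 2"
        using less.prems j by (auto dest: in_set_dropD)
      then show ?thesis
        using that chain_sum_row_bound unfolding T_def by metis
    qed
    have "summable (\<lambda>M. K * C * (1 / real (Suc M) ^ 2))"
      using inverse_power_summable[of 2, where 'a = real]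
      by (intro summable_mult) (subst summable_Suc_iff, simp add: inverse_eq_divide)
    then show ?thesis
    proof (rule summable_comparison_test'[where N = 0])
      fix M :: nat
      have "norm (L (take j ks) M * T (drop j ks) (Suc M)) \<le> K * (C / real (Suc M) ^ 2)"
        unfolding norm_mult using K C[of "Suc M"] by (intro mult_mono) auto
      then show "norm (L (take j ks) M * T (drop j ks) (Suc M)) \<le> K * C * (1 / real (Suc M) ^ 2)"
        by simp
    qed
  qed
  then have "summable (\<lambda>M. L ks (Suc M) - L ks M)"
    unfolding step by (intro summable_sum) auto
  then have "convergent (\<lambda>M. \<Sum>i<M. L ks (Suc i) - L ks i)"
    by (simp add: summable_iff_convergent)
  then have "convergent (\<lambda>M. L ks M - L ks 0)"
    by (simp add: sum_lessThan_telescope)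
  then have "convergent (\<lambda>M. (L ks M - L ks 0) + L ks 0)"
    by (intro convergent_add convergent_const)
  then show ?case
    by (simp add: L_def)
qed

end

section \<open>Multiple Eisenstein series as limits of strip sums\<close>

definition strip_box :: "nat \<Rightarrow> nat \<Rightarrow> nat \<Rightarrow> (int \<times> int) set" where
  "strip_box M c d = {p \<in> strip M. - int c \<le> snd p \<and> snd p \<le> int d}"

lemma finite_strip_box: "finite (strip_box M c d)"
  by (rule finite_subset[of _ "{0..int M} \<times> {- int c..int d}"]) (auto simp: strip_box_def strip_def)

lemma box_subset_strip: "strip_box M c d \<subseteq> strip M"
  by (auto simp: strip_box_def)

lemma filterlim_strip_box:
  assumes "filterlim c sequentially \<F>" "filterlim d sequentially \<F>"
  shows "filterlim (\<lambda>x. strip_box M (c x) (d x)) (finite_subsets_at_top (strip M)) \<F>"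
  using finite_strip_box assms unfolding strip_box_def by (rule filterlim_window)

lemma lattice_less_iff:
  assumes "Im \<tau> > 0"
  shows "lattice_less \<tau> (lattice_point \<tau> p) (lattice_point \<tau> q) \<longleftrightarrow> p < q"
proof -
  have unique: "p = (m, n)" if "lattice_point \<tau> p = of_int m * \<tau> + of_int n" for p m n
  proof -
    have "Im (lattice_point \<tau> p) = real_of_int m * Im \<tau>"
      using that by simp
    then have m: "fst p = m"
      using assms by (simp add: lattice_point_def split_beta)
    then show ?thesis
      using that by (auto simp: lattice_point_def split_beta prod_eq_iff)
  qed
  show ?thesis
  proof
    assume "lattice_less \<tau> (lattice_point \<tau> p) (lattice_point \<tau> q)"
    then obtain m1 n1 m2 n2 where mn: "lattice_point \<tau> p = of_int m1 * \<tau> + of_int n1"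
        "lattice_point \<tau> q = of_int m2 * \<tau> + of_int n2" "m1 < m2 \<or> m1 = m2 \<and> n1 < n2"
      unfolding lattice_less_def by blast
    show "p < q"
      using mn(3) by (auto simp: unique[OF mn(1)] unique[OF mn(2)])
  next
    assume "p < q"
    then show "lattice_less \<tau> (lattice_point \<tau> p) (lattice_point \<tau> q)"
      unfolding lattice_less_def
      by (intro exI[of _ "fst p"] exI[of _ "snd p"] exI[of _ "fst q"] exI[of _ "snd q"])
        (auto simp: lattice_point_def split_beta less_prod_def')
  qed
qed

lemma inj_lattice_point:
  assumes "Im \<tau> > 0"
  shows "inj (lattice_point \<tau>)"
proof (rule injI)
  fix p q assume "lattice_point \<tau> p = lattice_point \<tau> q"
  then have "\<not> p < q" "\<not> q < p"
    using lattice_less_iff[OF assms, of p q] lattice_less_iff[OF assms, of q p]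
      lattice_less_iff[OF assms, of p p] by simp_all
  then show "p = q"
    by simp
qed

lemma lattice_chains_eq:
  assumes "Im \<tau> > 0"
  shows "lattice_chains \<tau> l (Suc M) (Suc N) = map (lattice_point \<tau>) ` sorted_chains l (strip_box M N N)"
proof -
  define R where "R = {p::int \<times> int. \<bar>fst p\<bar> < int (Suc M) \<and> \<bar>snd p\<bar> < int (Suc N)}"
  have lbox: "lattice_box \<tau> (Suc M) (Suc N) = lattice_point \<tau> ` R"
    by (force simp: lattice_box_def int_ball_def R_def lattice_point_def)
  have succ: "successively (lattice_less \<tau>) (0 # map (lattice_point \<tau>) us) \<longleftrightarrow> sorted_wrt (<) ((0, 0) # us)" for us
  proof -
    have "0 # map (lattice_point \<tau>) us = map (lattice_point \<tau>) ((0, 0) # us)"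
      by (simp add: lattice_point_def)
    then have "successively (lattice_less \<tau>) (0 # map (lattice_point \<tau>) us) \<longleftrightarrow> successively (<) ((0, 0) # us)"
      by (simp only: successively_map lattice_less_iff[OF assms])
    also have "\<dots> \<longleftrightarrow> sorted_wrt (<) ((0, 0) # us)"
      by (rule successively_conv_sorted_wrt) (auto intro: transpI)
    finally show ?thesis .
  qed
  have positive: "strip_box M N N = {p \<in> R. (0, 0) < p}"
    by (auto simp: strip_box_def strip_def R_def)
  show ?thesis
  proof (intro equalityI subsetI)
    fix ws assume ws: "ws \<in> lattice_chains \<tau> l (Suc M) (Suc N)"
    then have "ws \<in> lists (lattice_point \<tau> ` R)"
      by (auto simp: lattice_chains_def lbox)
    then obtain us where us: "us \<in> lists R" "ws = map (lattice_point \<tau>) us"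
      unfolding lists_image by blast
    have "sorted_wrt (<) ((0, 0) # us)"
      using ws us(2) by (simp only: lattice_chains_def succ mem_Collect_eq)
    then have "us \<in> sorted_chains l (strip_box M N N)"
      using ws us by (auto simp: sorted_chains_def lattice_chains_def positive)
    then show "ws \<in> map (lattice_point \<tau>) ` sorted_chains l (strip_box M N N)"
      using us by blast
  next
    fix ws assume "ws \<in> map (lattice_point \<tau>) ` sorted_chains l (strip_box M N N)"
    then obtain us where us: "ws = map (lattice_point \<tau>) us" "us \<in> sorted_chains l (strip_box M N N)"
      by blast
    have "sorted_wrt (<) ((0, 0) # us)"
      using us by (auto simp: sorted_chains_def positive)
    then show "ws \<in> lattice_chains \<tau> l (Suc M) (Suc N)"
      using us succ[of us] by (auto simp: lattice_chains_def sorted_chains_def positive lbox)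
  qed
qed

lemma mult_eisenstein_partial_eq:
  assumes "Im \<tau> > 0"
  shows "mult_eisenstein_partial \<tau> ks (Suc M) (Suc N) = chain_sum (lattice_point \<tau>) ks (strip_box M N N)"
proof -
  have inj: "inj_on (map (lattice_point \<tau>)) (sorted_chains (length ks) (strip_box M N N))"
    by (intro inj_on_subset[OF inj_mapI] inj_lattice_point assms) auto
  have "chain_sum (lattice_point \<tau>) ks (strip_box M N N)
      = (\<Sum>us\<in>sorted_chains (length ks) (strip_box M N N). \<Prod>j<length ks. 1 / (map (lattice_point \<tau>) us ! j) ^ (ks ! j))"
    unfolding chain_sum_finite[OF finite_strip_box]
    by (intro sum.cong refl) (auto simp: sorted_chains_def chain_term_nth intro!: prod.cong)
  then show ?thesis
    unfolding mult_eisenstein_partial_def lattice_chains_eq[OF assms] sum.reindex[OF inj] by simp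
qed

lemma mult_eisenstein_tendsto:
  assumes "Im \<tau> > 0" "\<And>k. k \<in> set ks \<Longrightarrow> k \<ge> 2"
  shows "(\<lambda>M. chain_sum (lattice_point \<tau>) ks (strip M)) \<longlonglongrightarrow> mult_eisenstein \<tau> ks"
proof -
  \<comment> \<open>The condition \<open>\<bar>m\<bar> < M\<close> with \<open>M + 1\<close> in place of \<open>M\<close> leaves the rows \<open>0, \<dots>, M\<close> of the strip.\<close>
  have inner: "lim (\<lambda>N. mult_eisenstein_partial \<tau> ks (Suc M) N) = chain_sum (lattice_point \<tau>) ks (strip M)" for M
  proof -
    have "(\<lambda>N. mult_eisenstein_partial \<tau> ks (Suc M) (Suc N)) \<longlonglongrightarrow> chain_sum (lattice_point \<tau>) ks (strip M)"
      unfolding mult_eisenstein_partial_eq[OF assms(1)]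
      by (intro tendsto_chain_sum filterlim_strip_box filterlim_ident strip_summable assms)
    then show ?thesis
      by (rule limI[OF LIMSEQ_imp_Suc])
  qed
  obtain l where l: "(\<lambda>M. chain_sum (lattice_point \<tau>) ks (strip M)) \<longlonglongrightarrow> l"
    using convergent_chain_sum_strip[OF assms] by (auto simp: convergent_def)
  then have "(\<lambda>M. lim (\<lambda>N. mult_eisenstein_partial \<tau> ks (Suc M) N)) \<longlonglongrightarrow> l"
    by (simp only: inner)
  then have "mult_eisenstein \<tau> ks = l"
    unfolding mult_eisenstein_def by (rule limI[OF LIMSEQ_imp_Suc])
  then show ?thesis
    using l by simp
qed

section \<open>Averaging the residues over a rectangle\<close>

definition rect :: "nat \<Rightarrow> nat \<Rightarrow> (int \<times> int) set" where
  "rect A C = {0..int A} \<times> {0..int C}"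

lemma chain_sum_rect_above:
  assumes "a \<le> A" "c \<le> C"
  defines "s \<equiv> (int a, int c)"
  shows "chain_sum (\<lambda>x. lattice_point \<tau> x - lattice_point \<tau> s) ks {x \<in> rect A C. s < x}
    = chain_sum (lattice_point \<tau>) ks (strip_box (A - a) c (C - c))"
proof -
  let ?h = "\<lambda>x. (fst x + int a, snd x + int c)"
  have img: "{x \<in> rect A C. s < x} = ?h ` strip_box (A - a) c (C - c)"
  proof (intro equalityI subsetI)
    fix x assume x: "x \<in> {x \<in> rect A C. s < x}"
    have "(fst x - int a, snd x - int c) \<in> strip_box (A - a) c (C - c)"
      using x assms by (auto simp: rect_def strip_box_def strip_def of_nat_diff)
    then show "x \<in> ?h ` strip_box (A - a) c (C - c)"
      by (rule rev_image_eqI) simp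
  qed (use assms in \<open>auto simp: rect_def strip_box_def strip_def of_nat_diff\<close>)
  have "strict_mono_on (strip_box (A - a) c (C - c)) ?h"
    by (auto simp: strict_mono_on_def less_prod_def')
  moreover have "(\<lambda>x. lattice_point \<tau> x - lattice_point \<tau> s) \<circ> ?h = lattice_point \<tau>"
    by (auto simp: lattice_point_def s_def fun_eq_iff algebra_simps)
  ultimately show ?thesis
    unfolding img by (simp only: chain_sum_image)
qed

lemma chain_sum_rect_below:
  assumes "a \<le> A" "c \<le> C"
  defines "s \<equiv> (int a, int c)"
  shows "chain_sum (\<lambda>x. lattice_point \<tau> s - lattice_point \<tau> x) ks {x \<in> rect A C. x < s}
    = chain_sum (lattice_point \<tau>) (rev ks) (strip_box a (C - c) c)"
proof -
  let ?h = "\<lambda>x. (int a - fst x, int c - snd x)"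
  have img: "?h ` {x \<in> rect A C. x < s} = strip_box a (C - c) c"
  proof (intro equalityI subsetI)
    fix x assume x: "x \<in> strip_box a (C - c) c"
    have "?h x \<in> {x \<in> rect A C. x < s}"
      using x assms by (auto simp: rect_def strip_box_def strip_def of_nat_diff less_prod_def')
    then show "x \<in> ?h ` {x \<in> rect A C. x < s}"
      by (rule rev_image_eqI) simp
  qed (use assms in \<open>auto simp: rect_def strip_box_def strip_def of_nat_diff less_prod_def'\<close>)
  have "chain_sum (lattice_point \<tau>) (rev ks) (?h ` {x \<in> rect A C. x < s})
      = chain_sum (\<lambda>x. lattice_point \<tau> s - lattice_point \<tau> x) ks {x \<in> rect A C. x < s}"
    by (rule chain_sum_antimono_image[where g = ?h])
      (auto simp: less_prod_def' lattice_point_def s_def algebra_simps)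
  then show ?thesis
    unfolding img by simp
qed

text \<open>
Here the cancellation of residues is summed over all chains in a rectangle and the chains are
grouped by the point \<open>s = (a, c)\<close> at position \<open>i\<close>. Seen from \<open>s\<close>, the rectangle is a box around
the origin whose four extents depend on \<open>s\<close>, and the chains above and below \<open>s\<close> become two
independent chains starting at the origin.
\<close>

lemma sum_residue_coeff_boxes:
  assumes "Im \<tau> > 0" "r \<ge> 1" "\<And>i. i \<in> {1..r} \<Longrightarrow> ks i \<ge> 2" "(\<Sum>i=1..r. ks i) = k"
  shows "(\<Sum>i=1..r. \<Sum>n\<in>residue_tuples r k i. residue_coeff ks r i n *
      (\<Sum>a\<le>A. \<Sum>c\<le>C. chain_sum (lattice_point \<tau>) (map n (rev [1..<i])) (strip_box a (C - c) c)
          * chain_sum (lattice_point \<tau>) (map n [Suc i..<Suc r]) (strip_box (A - a) c (C - c)))) = 0"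
proof -
  let ?P = "lattice_point \<tau>"
  define S where "S = rect A C"
  have finS: "finite S"
    by (simp add: S_def rect_def)
  define w where "w ws p = ?P (ws ! (p - 1))" for ws :: "(int \<times> int) list" and p :: nat
  define lower where "lower i n ws = (\<Prod>p\<in>{1..<i}. 1 / (w ws i - w ws p) ^ n p)" for i ws and n :: "nat \<Rightarrow> nat"
  define upper where "upper i n ws = (\<Prod>p\<in>{Suc i..r}. 1 / (w ws p - w ws i) ^ n p)" for i ws and n :: "nat \<Rightarrow> nat"
  have chain: "(\<Sum>i=1..r. \<Sum>n\<in>residue_tuples r k i. residue_coeff ks r i n * (lower i n ws * upper i n ws)) = 0"
    if ws: "ws \<in> sorted_chains r S" for ws
  proof -
    have "distinct ws" "length ws = r"
      using ws by (auto simp: sorted_chains_def strict_sorted_iff)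
    have "inj_on (w ws) {1..r}"
    proof (rule inj_onI)
      fix x y assume xy: "x \<in> {1..r}" "y \<in> {1..r}" "w ws x = w ws y"
      then have "ws ! (x - 1) = ws ! (y - 1)"
        using injD[OF inj_lattice_point[OF assms(1)]] by (simp add: w_def)
      then have "x - 1 = y - 1"
        using \<open>distinct ws\<close> \<open>length ws = r\<close> xy by (subst (asm) nth_eq_iff_index_eq) auto
      then show "x = y"
        using xy by auto
    qed
    from sum_residues_chain[OF assms(2) this assms(3,4)] show ?thesis
      by (simp add: lower_def upper_def mult.assoc)
  qed
  have position: "(\<Sum>ws\<in>sorted_chains r S. lower i n ws * upper i n ws)
    = (\<Sum>a\<le>A. \<Sum>c\<le>C. chain_sum ?P (map n (rev [1..<i])) (strip_box a (C - c) c)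
          * chain_sum ?P (map n [Suc i..<Suc r]) (strip_box (A - a) c (C - c)))"
    if i: "i \<in> {1..r}" for i n
  proof -
    define below where "below s = chain_term (\<lambda>x. ?P s - ?P x) (map n [1..<i])" for s
    define above where "above s = chain_term (\<lambda>x. ?P x - ?P s) (map n [Suc i..<Suc r])" for s
    have lower: "lower i n ws = below (ws ! (i - 1)) (take (i - 1) ws)"
      and upper: "upper i n ws = above (ws ! (i - 1)) (drop (Suc (i - 1)) ws)"
      if ws: "ws \<in> sorted_chains r S" for ws
    proof -
      have len: "length ws = r"
        using ws by (simp add: sorted_chains_def)
      have "below (ws ! (i - 1)) (take (i - 1) ws)
          = (\<Prod>j<i - 1. 1 / (?P (ws ! (i - 1)) - ?P (ws ! j)) ^ n (Suc j))"
        unfolding below_def using i len by (subst chain_term_nth) auto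
      also have "\<dots> = lower i n ws"
        unfolding lower_def w_def
        by (rule prod.reindex_bij_witness[where i = "\<lambda>p. p - 1" and j = Suc]) auto
      finally show "lower i n ws = below (ws ! (i - 1)) (take (i - 1) ws)" ..
      have "above (ws ! (i - 1)) (drop (Suc (i - 1)) ws)
          = (\<Prod>j<r - i. 1 / (?P (ws ! (i + j)) - ?P (ws ! (i - 1))) ^ n (Suc (i + j)))"
        unfolding above_def using i len by (subst chain_term_nth) (auto simp del: upt_Suc)
      also have "\<dots> = upper i n ws"
        unfolding upper_def w_def
        by (rule prod.reindex_bij_witness[where i = "\<lambda>p. p - Suc i" and j = "\<lambda>j. Suc (i + j)"]) (use i in auto)
      finally show "upper i n ws = above (ws ! (i - 1)) (drop (Suc (i - 1)) ws)" ..
    qed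
    have "(\<Sum>ws\<in>sorted_chains r S. lower i n ws * upper i n ws)
        = (\<Sum>ws\<in>sorted_chains r S. below (ws ! (i - 1)) (take (i - 1) ws) * above (ws ! (i - 1)) (drop (Suc (i - 1)) ws))"
      by (intro sum.cong refl) (simp only: lower upper)
    also have "\<dots> = (\<Sum>s\<in>S. \<Sum>us\<in>sorted_chains (i - 1) {x\<in>S. x < s}.
        \<Sum>vs\<in>sorted_chains (r - Suc (i - 1)) {x\<in>S. s < x}. below s us * above s vs)"
      using i by (intro sum_chains_split_at[OF finS]) auto
    also have "\<dots> = (\<Sum>s\<in>S. chain_sum (\<lambda>x. ?P s - ?P x) (map n [1..<i]) {x\<in>S. x < s}
        * chain_sum (\<lambda>x. ?P x - ?P s) (map n [Suc i..<Suc r]) {x\<in>S. s < x})"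
      using i finS by (intro sum.cong refl) (simp add: chain_sum_finite sum_product below_def above_def del: upt_Suc)
    also have "\<dots> = (\<Sum>(a, c)\<in>{..A} \<times> {..C}. chain_sum ?P (map n (rev [1..<i])) (strip_box a (C - c) c)
          * chain_sum ?P (map n [Suc i..<Suc r]) (strip_box (A - a) c (C - c)))"
    proof (rule sum.reindex_bij_witness[where i = "\<lambda>(a, c). (int a, int c)" and j = "\<lambda>s. (nat (fst s), nat (snd s))"])
      fix s assume s: "s \<in> S"
      then obtain a c where "s = (int a, int c)" "a \<le> A" "c \<le> C"
        by (cases s) (auto simp: S_def rect_def elim!: nonneg_int_cases)
      then show "(case (nat (fst s), nat (snd s)) of (a, c) \<Rightarrow>
          chain_sum ?P (map n (rev [1..<i])) (strip_box a (C - c) c)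
          * chain_sum ?P (map n [Suc i..<Suc r]) (strip_box (A - a) c (C - c)))
        = chain_sum (\<lambda>x. ?P s - ?P x) (map n [1..<i]) {x\<in>S. x < s}
        * chain_sum (\<lambda>x. ?P x - ?P s) (map n [Suc i..<Suc r]) {x\<in>S. s < x}"
        by (simp add: S_def chain_sum_rect_above chain_sum_rect_below rev_map del: upt_Suc)
    qed (auto simp: S_def rect_def)
    finally show ?thesis
      by (simp add: sum.cartesian_product)
  qed
  have "0 = (\<Sum>ws\<in>sorted_chains r S. \<Sum>i=1..r. \<Sum>n\<in>residue_tuples r k i.
      residue_coeff ks r i n * (lower i n ws * upper i n ws))"
    using chain by simp
  also have "\<dots> = (\<Sum>i=1..r. \<Sum>ws\<in>sorted_chains r S. \<Sum>n\<in>residue_tuples r k i.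
      residue_coeff ks r i n * (lower i n ws * upper i n ws))"
    by (rule sum.swap)
  also have "\<dots> = (\<Sum>i=1..r. \<Sum>n\<in>residue_tuples r k i. \<Sum>ws\<in>sorted_chains r S.
      residue_coeff ks r i n * (lower i n ws * upper i n ws))"
    by (intro sum.cong refl sum.swap)
  also have "\<dots> = (\<Sum>i=1..r. \<Sum>n\<in>residue_tuples r k i. residue_coeff ks r i n *
      (\<Sum>a\<le>A. \<Sum>c\<le>C. chain_sum ?P (map n (rev [1..<i])) (strip_box a (C - c) c)
          * chain_sum ?P (map n [Suc i..<Suc r]) (strip_box (A - a) c (C - c))))"
    by (intro sum.cong refl) (simp only: sum_distrib_left[symmetric] position)
  finally show ?thesis
    by simp
qed

text \<open>
Most pairs \<open>(c, N - c)\<close> have two large entries; the remaining ones are bounded in number and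
contribute bounded terms, so the average does not see them.
\<close>

lemma tendsto_average_antidiagonal:
  fixes g :: "nat \<Rightarrow> nat \<Rightarrow> complex"
  assumes lim: "((\<lambda>x. g (fst x) (snd x)) \<longlongrightarrow> L) (sequentially \<times>\<^sub>F sequentially)"
    and bound: "\<And>c d. norm (g c d) \<le> K"
  shows "(\<lambda>N. (\<Sum>c\<le>N. g c (N - c)) / of_nat (Suc N)) \<longlonglongrightarrow> L"
proof (rule LIMSEQ_I)
  fix e :: real assume e: "e > 0"
  define K' where "K' = K + norm L"
  have K': "norm (g c d - L) \<le> K'" for c d
    using bound[of c d] norm_triangle_ineq4[of "g c d" L] by (simp add: K'_def)
  have "K' \<ge> 0"
    using K'[of 0 0] norm_ge_zero order_trans by blast
  have "\<forall>\<^sub>F x in sequentially \<times>\<^sub>F sequentially. dist (g (fst x) (snd x)) L < e / 2"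
    using lim e by (intro tendstoD) auto
  then obtain n0 where n0: "\<And>c d. c \<ge> n0 \<Longrightarrow> d \<ge> n0 \<Longrightarrow> norm (g c d - L) < e / 2"
    unfolding eventually_prod_sequentially dist_norm by auto
  have card_le: "(\<Sum>c\<le>N. if c < n0 then K' else 0) \<le> real n0 * K'" for N :: nat
  proof -
    have "(\<Sum>c\<le>N. if c < n0 then K' else 0) = real (card {c \<in> {..N}. c < n0}) * K'"
      by (simp only: sum.inter_filter[symmetric] finite_atMost sum_constant)
    also have "\<dots> \<le> real (card {..<n0}) * K'"
      using \<open>K' \<ge> 0\<close> by (intro mult_right_mono of_nat_mono card_mono) auto
    finally show ?thesis
      by simp
  qed
  have avg: "norm ((\<Sum>c\<le>N. g c (N - c)) / of_nat (Suc N) - L) \<le> e / 2 + 2 * real n0 * K' / real (Suc N)" for N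
  proof -
    have "(\<Sum>c\<le>N. g c (N - c)) / of_nat (Suc N) - L = (\<Sum>c\<le>N. g c (N - c) - L) / of_nat (Suc N)"
      by (simp add: sum_subtractf diff_divide_distrib del: of_nat_Suc)
    also have "norm \<dots> = norm (\<Sum>c\<le>N. g c (N - c) - L) / real (Suc N)"
      by (simp add: norm_divide del: of_nat_Suc)
    also have "norm (\<Sum>c\<le>N. g c (N - c) - L)
        \<le> (\<Sum>c\<le>N. e / 2 + (if c < n0 then K' else 0) + (if N - c < n0 then K' else 0))"
    proof (rule sum_norm_le)
      fix c
      show "norm (g c (N - c) - L) \<le> e / 2 + (if c < n0 then K' else 0) + (if N - c < n0 then K' else 0)"
        using n0[of c "N - c"] K'[of c "N - c"] \<open>K' \<ge> 0\<close> e by (cases "c < n0"; cases "N - c < n0") auto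
    qed
    also have "\<dots> = real (Suc N) * (e / 2) + (\<Sum>c\<le>N. if c < n0 then K' else 0) + (\<Sum>c\<le>N. if N - c < n0 then K' else 0)"
      by (simp add: sum.distrib)
    also have "(\<Sum>c\<le>N. if N - c < n0 then K' else 0) = (\<Sum>c\<le>N. if c < n0 then K' else 0)"
      by (rule sum.reindex_bij_witness[where i = "\<lambda>c. N - c" and j = "\<lambda>c. N - c"]) auto
    also have "real (Suc N) * (e / 2) + (\<Sum>c\<le>N. if c < n0 then K' else 0) + (\<Sum>c\<le>N. if c < n0 then K' else 0)
        \<le> real (Suc N) * (e / 2) + 2 * real n0 * K'"
      using card_le[of N] by simp
    finally show ?thesis
      by (simp add: divide_right_mono add_divide_distrib del: of_nat_Suc)
  qed
  have "(\<lambda>N. 2 * real n0 * K' / real (Suc N)) \<longlonglongrightarrow> 0"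
    by (rule LIMSEQ_Suc[OF lim_const_over_n])
  then have "\<forall>\<^sub>F N in sequentially. 2 * real n0 * K' / real (Suc N) < e / 2"
    using e by (intro order_tendstoD) auto
  then obtain N0 where "\<And>N. N \<ge> N0 \<Longrightarrow> 2 * real n0 * K' / real (Suc N) < e / 2"
    unfolding eventually_sequentially by blast
  then show "\<exists>N0. \<forall>N\<ge>N0. norm ((\<Sum>c\<le>N. g c (N - c)) / of_nat (Suc N) - L) < e"
  proof (intro exI allI impI)
    fix N assume "N0 \<le> N"
    with \<open>\<And>N. N \<ge> N0 \<Longrightarrow> 2 * real n0 * K' / real (Suc N) < e / 2\<close>
    have "2 * real n0 * K' / real (Suc N) < e / 2"
      by blast
    then show "norm ((\<Sum>c\<le>N. g c (N - c)) / of_nat (Suc N) - L) < e"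
      using avg[of N] by linarith
  qed
qed

lemma average_box_products:
  assumes "Im \<tau> > 0" "\<And>k. k \<in> set us \<Longrightarrow> k \<ge> 2" "\<And>k. k \<in> set vs \<Longrightarrow> k \<ge> 2"
  shows "(\<lambda>C. (\<Sum>c\<le>C. chain_sum (lattice_point \<tau>) us (strip_box a (C - c) c)
        * chain_sum (lattice_point \<tau>) vs (strip_box b c (C - c))) / of_nat (Suc C))
      \<longlonglongrightarrow> chain_sum (lattice_point \<tau>) us (strip a) * chain_sum (lattice_point \<tau>) vs (strip b)"
proof (rule tendsto_average_antidiagonal[where
      g = "\<lambda>c d. chain_sum (lattice_point \<tau>) us (strip_box a d c) * chain_sum (lattice_point \<tau>) vs (strip_box b c d)"])
  show "((\<lambda>x. chain_sum (lattice_point \<tau>) us (strip_box a (snd x) (fst x))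
        * chain_sum (lattice_point \<tau>) vs (strip_box b (fst x) (snd x)))
      \<longlongrightarrow> chain_sum (lattice_point \<tau>) us (strip a) * chain_sum (lattice_point \<tau>) vs (strip b))
      (sequentially \<times>\<^sub>F sequentially)"
    by (intro tendsto_mult tendsto_chain_sum filterlim_strip_box filterlim_fst filterlim_snd strip_summable assms)
  show "norm (chain_sum (lattice_point \<tau>) us (strip_box a d c) * chain_sum (lattice_point \<tau>) vs (strip_box b c d))
      \<le> (\<Prod>k\<leftarrow>us. \<Sum>\<^sub>\<infinity>w\<in>strip a. 1 / norm (lattice_point \<tau> w) ^ k)
        * (\<Prod>k\<leftarrow>vs. \<Sum>\<^sub>\<infinity>w\<in>strip b. 1 / norm (lattice_point \<tau> w) ^ k)" for c d
    unfolding norm_mult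
    by (intro mult_mono norm_chain_sum_le strip_summable assms box_subset_strip norm_ge_zero prod_list_nonneg)
      (auto intro: infsum_nonneg)
qed

lemma average_strip_products:
  assumes "Im \<tau> > 0" "\<And>k. k \<in> set us \<Longrightarrow> k \<ge> 2" "\<And>k. k \<in> set vs \<Longrightarrow> k \<ge> 2"
  shows "(\<lambda>A. (\<Sum>a\<le>A. chain_sum (lattice_point \<tau>) us (strip a)
        * chain_sum (lattice_point \<tau>) vs (strip (A - a))) / of_nat (Suc A))
      \<longlonglongrightarrow> mult_eisenstein \<tau> us * mult_eisenstein \<tau> vs"
proof -
  have bounded: "\<exists>K. \<forall>M. norm (chain_sum (lattice_point \<tau>) ls (strip M)) \<le> K"
    if "\<And>k. k \<in> set ls \<Longrightarrow> k \<ge> 2" for ls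
    using convergent_imp_Bseq[OF convergent_chain_sum_strip[OF assms(1) that]] by (auto simp: Bseq_def)
  obtain K1 K2 where K: "\<And>M. norm (chain_sum (lattice_point \<tau>) us (strip M)) \<le> K1"
      "\<And>M. norm (chain_sum (lattice_point \<tau>) vs (strip M)) \<le> K2"
    using bounded[OF assms(2)] bounded[OF assms(3)] by blast
  have "K1 \<ge> 0"
    using K(1)[of 0] norm_ge_zero order_trans by blast
  show ?thesis
  proof (rule tendsto_average_antidiagonal[where
        g = "\<lambda>a b. chain_sum (lattice_point \<tau>) us (strip a) * chain_sum (lattice_point \<tau>) vs (strip b)"])
    show "((\<lambda>x. chain_sum (lattice_point \<tau>) us (strip (fst x)) * chain_sum (lattice_point \<tau>) vs (strip (snd x)))
        \<longlongrightarrow> mult_eisenstein \<tau> us * mult_eisenstein \<tau> vs) (sequentially \<times>\<^sub>F sequentially)"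
      by (intro tendsto_mult filterlim_compose[OF mult_eisenstein_tendsto filterlim_fst]
          filterlim_compose[OF mult_eisenstein_tendsto filterlim_snd] assms)
    show "norm (chain_sum (lattice_point \<tau>) us (strip a) * chain_sum (lattice_point \<tau>) vs (strip b)) \<le> K1 * K2" for a b
      unfolding norm_mult using \<open>K1 \<ge> 0\<close> by (intro mult_mono K) auto
  qed
qed

text \<open>
Tuples with an entry below \<open>2\<close> away from position \<open>i\<close> carry a vanishing binomial coefficient, so
only convergent multiple series are involved.
\<close>

lemma residue_coeff_entries:
  assumes "residue_coeff ks r i n \<noteq> 0" "i \<in> {1..r}" "\<And>p. p \<in> {1..r} \<Longrightarrow> ks p \<ge> 2"
  shows "\<And>m. m \<in> set (map n (rev [1..<i])) \<Longrightarrow> m \<ge> 2"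
    and "\<And>m. m \<in> set (map n [Suc i..<Suc r]) \<Longrightarrow> m \<ge> 2"
proof -
  have n: "n p \<ge> 2" if p: "p \<in> {1..r} - {i}" for p
  proof (rule ccontr)
    assume "\<not> n p \<ge> 2"
    then have "(n p - 1) choose (ks p - 1) = 0"
      using assms(3)[of p] p by (intro binomial_eq_0) auto
    then have "residue_coeff ks r i n = 0"
      using p unfolding residue_coeff_def by (auto intro!: prod_zero)
    then show False
      using assms(1) by simp
  qed
  show "m \<ge> 2" if "m \<in> set (map n (rev [1..<i]))" for m
    using that n assms(2) by auto
  show "m \<ge> 2" if "m \<in> set (map n [Suc i..<Suc r])" for m
    using that n assms(2) by (auto simp del: upt_Suc)
qed

theorem corollary4p3:
  fixes \<tau> :: complex and r k :: nat and ks :: "nat \<Rightarrow> nat"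
  assumes "Im \<tau> > 0"
    and "r \<ge> 1"
    and "\<And>i. i \<in> {1..r} \<Longrightarrow> ks i \<ge> 2"
    and "(\<Sum>i=1..r. ks i) = k"
  shows "(\<Sum>i=1..r. \<Sum>n | n \<in> {1..r} \<rightarrow>\<^sub>E (UNIV :: nat set) \<and> (\<Sum>p=1..r. n p) = k \<and> n i = 1.
            (- 1) ^ (ks i + (\<Sum>p=i..r. n p))
            * (\<Prod>p\<in>{1..r} - {i}. of_nat ((n p - 1) choose (ks p - 1)))
            * mult_eisenstein \<tau> (map n (rev [1..<i]))
            * mult_eisenstein \<tau> (map n [Suc i..<Suc r])) = 0"
proof -
  let ?Z = "\<lambda>ls X. chain_sum (lattice_point \<tau>) ls X"
  define coeff where "coeff = residue_coeff ks r"
  define U where "U i n = map n (rev [1..<i])" for i and n :: "nat \<Rightarrow> nat"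
  define V where "V i n = map n [Suc i..<Suc r]" for i and n :: "nat \<Rightarrow> nat"
  have entries: "k \<ge> 2" if "coeff i n \<noteq> 0" "i \<in> {1..r}" "k \<in> set (U i n) \<union> set (V i n)" for i n k
    using residue_coeff_entries[OF that(1)[unfolded coeff_def] that(2) assms(3)] that(3)
    unfolding U_def V_def by blast

  \<comment> \<open>The width of the rectangle tends to infinity first, then its height, in accordance with the
    order of the two limits in the definition of the series.\<close>
  have strips: "(\<Sum>i=1..r. \<Sum>n\<in>residue_tuples r k i. coeff i n *
      (\<Sum>a\<le>A. ?Z (U i n) (strip a) * ?Z (V i n) (strip (A - a)))) = 0" for A
  proof (rule LIMSEQ_unique)
    have "(\<lambda>C. coeff i n * (\<Sum>a\<le>A. (\<Sum>c\<le>C. ?Z (U i n) (strip_box a (C - c) c) * ?Z (V i n) (strip_box (A - a) c (C - c))) / of_nat (Suc C)))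
       \<longlonglongrightarrow> coeff i n * (\<Sum>a\<le>A. ?Z (U i n) (strip a) * ?Z (V i n) (strip (A - a)))"
      if i: "i \<in> {1..r}" for i n
    proof (cases "coeff i n = 0")
      case False
      then show ?thesis
        using entries[OF False i] assms(1)
        by (intro tendsto_mult_left tendsto_sum average_box_products) auto
    qed simp
    then show "(\<lambda>C. \<Sum>i=1..r. \<Sum>n\<in>residue_tuples r k i. coeff i n *
        (\<Sum>a\<le>A. (\<Sum>c\<le>C. ?Z (U i n) (strip_box a (C - c) c) * ?Z (V i n) (strip_box (A - a) c (C - c))) / of_nat (Suc C)))
       \<longlonglongrightarrow> (\<Sum>i=1..r. \<Sum>n\<in>residue_tuples r k i. coeff i n *
        (\<Sum>a\<le>A. ?Z (U i n) (strip a) * ?Z (V i n) (strip (A - a))))"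
      by (intro tendsto_sum) auto
    have "(\<Sum>i=1..r. \<Sum>n\<in>residue_tuples r k i. coeff i n *
        (\<Sum>a\<le>A. (\<Sum>c\<le>C. ?Z (U i n) (strip_box a (C - c) c) * ?Z (V i n) (strip_box (A - a) c (C - c))) / of_nat (Suc C))) = 0" for C
      using sum_residue_coeff_boxes[OF assms, where A = A and C = C]
      by (simp only: sum_divide_distrib[symmetric] times_divide_eq_right coeff_def U_def V_def div_0)
    then show "(\<lambda>C. \<Sum>i=1..r. \<Sum>n\<in>residue_tuples r k i. coeff i n *
        (\<Sum>a\<le>A. (\<Sum>c\<le>C. ?Z (U i n) (strip_box a (C - c) c) * ?Z (V i n) (strip_box (A - a) c (C - c))) / of_nat (Suc C)))
       \<longlonglongrightarrow> 0"
      by simp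
  qed

  have "(\<Sum>i=1..r. \<Sum>n\<in>residue_tuples r k i.
      coeff i n * (mult_eisenstein \<tau> (U i n) * mult_eisenstein \<tau> (V i n))) = 0"
  proof (rule LIMSEQ_unique)
    have "(\<lambda>A. coeff i n * ((\<Sum>a\<le>A. ?Z (U i n) (strip a) * ?Z (V i n) (strip (A - a))) / of_nat (Suc A)))
       \<longlonglongrightarrow> coeff i n * (mult_eisenstein \<tau> (U i n) * mult_eisenstein \<tau> (V i n))"
      if i: "i \<in> {1..r}" for i n
    proof (cases "coeff i n = 0")
      case False
      then show ?thesis
        using entries[OF False i] assms(1) by (intro tendsto_mult_left average_strip_products) auto
    qed simp
    then show "(\<lambda>A. \<Sum>i=1..r. \<Sum>n\<in>residue_tuples r k i. coeff i n *
        ((\<Sum>a\<le>A. ?Z (U i n) (strip a) * ?Z (V i n) (strip (A - a))) / of_nat (Suc A)))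
       \<longlonglongrightarrow> (\<Sum>i=1..r. \<Sum>n\<in>residue_tuples r k i.
          coeff i n * (mult_eisenstein \<tau> (U i n) * mult_eisenstein \<tau> (V i n)))"
      by (intro tendsto_sum) auto
    have "(\<Sum>i=1..r. \<Sum>n\<in>residue_tuples r k i. coeff i n *
        ((\<Sum>a\<le>A. ?Z (U i n) (strip a) * ?Z (V i n) (strip (A - a))) / of_nat (Suc A))) = 0" for A
      using strips[of A] by (simp only: sum_divide_distrib[symmetric] times_divide_eq_right div_0)
    then show "(\<lambda>A. \<Sum>i=1..r. \<Sum>n\<in>residue_tuples r k i. coeff i n *
        ((\<Sum>a\<le>A. ?Z (U i n) (strip a) * ?Z (V i n) (strip (A - a))) / of_nat (Suc A))) \<longlonglongrightarrow> 0"
      by simp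
  qed
  then show ?thesis
    by (simp only: coeff_def residue_coeff_def U_def V_def mult.assoc)
qed

end
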